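(* The optimal sampled-data control $u^*_h=\sum_{i=0}^{N-1}U^*_{h,i}\,\mathbf{1}_{[s_i,s_{i+1})}$ is given in closed-loop form by $$U^*_{h,i}=-T_i^{-1}\big(P_i\,q(s_i,u^*_h)+H_i\big)\qquad\text{for every } i=0,\dots,N-1.$$ Moreover, the corresponding optimal cost is $$C(u^*_h)=\tfrac12\langle K_0q_a,q_a\rangle+\langle J_0,q_a\rangle+\tfrac12Y_0 .$$
   Context: Let $m,n\ge 1$ be integers and $a<b$ real numbers. Let $q_a,q_b\in\mathbb{R}^n$, let $S\in\mathbb{R}^{n\times n}$ be symmetric positive-semidefinite, let $x,\omega:[a,b]\to\mathbb{R}^n$ and $v:[a,b]\to\mathbb{R}^m$ be continuous, and let $A:[a,b]\to\mathbb{R}^{n\times n}$, $B:[a,b]\to\mathbb{R}^{n\times m}$, $W:[a,b]\to\mathbb{R}^{n\times n}$, $R:[a,b]\to\mathbb{R}^{m\times m}$ be continuous, with $W(t)$ symmetric positive-semidefinite and $R(t)$ symmetric positive-definite for every $t\in[a,b]$. For $u\in L^2([a,b],\mathbb{R}^m)$, let $q(\cdot,u)$ denote the unique absolutely continuous solution on $[a,b]$ of $\dot q(t)=A(t)q(t)+B(t)u(t)+\omega(t)$ for a.e. $t\in[a,b]$, $q(a)=q_a$. Define the cost $$C(u):=\tfrac12\langle S(q(b,u)-q_b),q(b,u)-q_b\rangle+\tfrac12\int_a^b\Big(\langle W(\tau)(q(\tau,u)-x(\tau)),q(\tau,u)-x(\tau)\rangle+\langle R(\tau)(u(\tau)-v(\tau)),u(\tau)-v(\tau)\rangle\Big)d\tau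 .$$ Fix $N\ge1$ and $h=(h_i)_{i=0,\dots,N-1}\in(0,+\infty)^N$ with $\sum_{i=0}^{N-1}h_i=b-a$, and set $s_i:=a+\sum_{j=0}^{i-1}h_j$ for $i=0,\dots,N$. Let $E_h$ be the set of functions $u:[a,b)\to\mathbb{R}^m$ constant on each $[s_i,s_{i+1})$, $i=0,\dots,N-1$. The optimal sampled-data control $u^*_h\in E_h$ is the unique minimizer of $C$ over $E_h$ (existence and uniqueness are standard), and $U^*_{h,i}\in\mathbb{R}^m$ denotes its value on $[s_i,s_{i+1})$. State-transition matrix: for $s\in[a,b]$, $Z(\cdot,s):[a,b]\to\mathbb{R}^{n\times n}$ is the solution of $\frac{d}{dt}Z(t,s)=A(t)Z(t,s)$, $Z(s,s)=\mathrm{Id}_n$. For $i=0,\dots,N-1$ and $\tau\in[s_i,s_{i+1}]$, abbreviate $\beta_i(\tau):=\int_{s_i}^\tau Z(\tau,s)B(s)\,ds\in\mathbb{R}^{n\times m}$ and $\gamma_i(\tau):=\int_{s_i}^\tau Z(\tau,s)\omega(s)\,ds-x(\tau)\in\mathbb{R}^n$, and define (multi-letter names are single symbols) - $\mathrm{ZB}_i:=\int_{s_i}^{s_{i+1}}Z(s_{i+1},s)B(s)\,ds\in\mathbb{R}^{n\times m}$; - $\mathrm{Z}\Omega_i:=\int_{s_i}^{s_{i+1}}Z(s_{i+1},s)\omega(s)\,ds\in\mathbb{R}^n$ if $0\le i\le N-2$, and $\mathrm{Z}\Omega_{N-1}:=\int_{s_{N-1}}^{s_N}Z(s_N,s)\omega(s)\,ds-q_b$;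 - $\mathrm{ZWZ}_i:=\int_{s_i}^{s_{i+1}}Z(\tau,s_i)^\top W(\tau)Z(\tau,s_i)\,d\tau\in\mathbb{R}^{n\times n}$; - $\mathrm{ZBWZ}_i:=\int_{s_i}^{s_{i+1}}\beta_i(\tau)^\top W(\tau)Z(\tau,s_i)\,d\tau\in\mathbb{R}^{m\times n}$; - $\mathrm{ZBWZB}_i:=\int_{s_i}^{s_{i+1}}\beta_i(\tau)^\top W(\tau)\beta_i(\tau)\,d\tau\in\mathbb{R}^{m\times m}$; - $\mathrm{ZBWZ}\Omega\mathrm{X}_i:=\int_{s_i}^{s_{i+1}}\beta_i(\tau)^\top W(\tau)\gamma_i(\tau)\,d\tau\in\mathbb{R}^m$; - $\mathrm{ZWZ}\Omega\mathrm{X}_i:=\int_{s_i}^{s_{i+1}}Z(\tau,s_i)^\top W(\tau)\gamma_i(\tau)\,d\tau\in\mathbb{R}^n$; - $\mathrm{WZ}\Omega\mathrm{X}^2_i:=\int_{s_i}^{s_{i+1}}\langle W(\tau)\gamma_i(\tau),\gamma_i(\tau)\rangle\,d\tau\in\mathbb{R}$; - $\mathrm{R}_i:=\int_{s_i}^{s_{i+1}}R(s)\,ds\in\mathbb{R}^{m\times m}$, $\mathrm{RV}_i:=\int_{s_i}^{s_{i+1}}R(s)v(s)\,ds\in\mathbb{R}^m$, $\mathrm{RV}^2_i:=\int_{s_i}^{s_{i+1}}\langle R(\tau)v(\tau),v(\tau)\rangle\,d\tau\in\mathbb{R}$. Define by backward recursion $K_N:=S$, $J_N:=0\in\mathbb{R}^n$,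 $Y_N:=0\in\mathbb{R}$ and, for $i=N-1,\dots,0$, $$F_i:=\langle K_{i+1}\mathrm{Z}\Omega_i,\mathrm{Z}\Omega_i\rangle+\mathrm{WZ}\Omega\mathrm{X}^2_i+\mathrm{RV}^2_i+2\langle J_{i+1},\mathrm{Z}\Omega_i\rangle+Y_{i+1},$$ $$G_i:=Z(s_{i+1},s_i)^\top K_{i+1}\mathrm{Z}\Omega_i+\mathrm{ZWZ}\Omega\mathrm{X}_i+Z(s_{i+1},s_i)^\top J_{i+1},$$ $$H_i:=\mathrm{ZB}_i^\top K_{i+1}\mathrm{Z}\Omega_i+\mathrm{ZBWZ}\Omega\mathrm{X}_i-\mathrm{RV}_i+\mathrm{ZB}_i^\top J_{i+1},$$ $$P_i:=\mathrm{ZB}_i^\top K_{i+1}Z(s_{i+1},s_i)+\mathrm{ZBWZ}_i,\qquad Q_i:=Z(s_{i+1},s_i)^\top K_{i+1}Z(s_{i+1},s_i)+\mathrm{ZWZ}_i,$$ $$T_i:=\mathrm{ZB}_i^\top K_{i+1}\mathrm{ZB}_i+\mathrm{ZBWZB}_i+\mathrm{R}_i,$$ $$K_i:=Q_i-P_i^\top T_i^{-1}P_i,\qquad J_i:=G_i-P_i^\top T_i^{-1}H_i,\qquad Y_i:=F_i-\langle T_i^{-1}H_i,H_i\rangle .$$ These sequences are well defined: each $K_{i+1}$ is positive-semidefinite, hence each $T_i$ is positive-definite and invertible. *)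

theory Defs
  imports "HOL-Analysis.Analysis"
begin

definition pos_semidef :: "real^'n^'n \<Rightarrow> bool" where
  "pos_semidef M \<longleftrightarrow> transpose M = M \<and> (\<forall>x. 0 \<le> (M *v x) \<bullet> x)"

definition pos_def :: "real^'n^'n \<Rightarrow> bool" where
  "pos_def M \<longleftrightarrow> transpose M = M \<and> (\<forall>x. x \<noteq> 0 \<longrightarrow> 0 < (M *v x) \<bullet> x)"

text \<open>Absolute continuity of a function on a compact interval. (The library's
  \<open>absolutely_continuous\<close> is about measures.)\<close>

definition abs_continuous_on :: "real \<Rightarrow> real \<Rightarrow> (real \<Rightarrow> 'a::real_normed_vector) \<Rightarrow> bool" where
  "abs_continuous_on a b f \<longleftrightarrow>
     (\<forall>\<epsilon>>0. \<exists>\<delta>>0. \<forall>(k::nat) (l::nat \<Rightarrow> real) (r::nat \<Rightarrow> real).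
        (\<forall>j<k. a \<le> l j \<and> l j \<le> r j \<and> r j \<le> b) \<and>
        disjoint_family_on (\<lambda>j. {l j<..<r j}) {..<k} \<and>
        (\<Sum>j<k. r j - l j) < \<delta>
        \<longrightarrow> (\<Sum>j<k. norm (f (r j) - f (l j))) < \<epsilon>)"


section \<open>The linear-quadratic problem\<close>

text \<open>A matrix in \<open>\<real>\<^sup>n\<^sup>\<times>\<^sup>m\<close> has type \<open>real^'m^'n\<close>. The functions of time are total;
  only their values on \<open>{ta..tb}\<close> matter.\<close>

record ('n, 'm) lq_problem =
  ta :: real
  tb :: real
  qa :: "real^'n"
  qb :: "real^'n"
  Smat :: "real^'n^'n"
  xref :: "real \<Rightarrow> real^'n"
  omega :: "real \<Rightarrow> real^'n"
  vref :: "real \<Rightarrow> real^'m"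
  Amat :: "real \<Rightarrow> real^'n^'n"
  Bmat :: "real \<Rightarrow> real^'m^'n"
  Wmat :: "real \<Rightarrow> real^'n^'n"
  Rmat :: "real \<Rightarrow> real^'m^'m"

definition valid_lq :: "('n::finite, 'm::finite) lq_problem \<Rightarrow> bool" where
  "valid_lq p \<longleftrightarrow>
     ta p < tb p \<and>
     pos_semidef (Smat p) \<and>
     continuous_on {ta p..tb p} (xref p) \<and>
     continuous_on {ta p..tb p} (omega p) \<and>
     continuous_on {ta p..tb p} (vref p) \<and>
     continuous_on {ta p..tb p} (Amat p) \<and>
     continuous_on {ta p..tb p} (Bmat p) \<and>
     continuous_on {ta p..tb p} (Wmat p) \<and>
     continuous_on {ta p..tb p} (Rmat p) \<and>
     (\<forall>t\<in>{ta p..tb p}. pos_semidef (Wmat p t) \<and> pos_def (Rmat p t))"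

text \<open>Functions on \<open>{ta..tb}\<close> are normalised to vanish outside that interval, so that the
  solutions of the differential equations are unique as total functions.\<close>

definition is_state ::
    "('n::finite, 'm::finite) lq_problem \<Rightarrow> (real \<Rightarrow> real^'m) \<Rightarrow> (real \<Rightarrow> real^'n) \<Rightarrow> bool" where
  "is_state p u q \<longleftrightarrow>
     abs_continuous_on (ta p) (tb p) q \<and>
     (AE t in lebesgue. t \<in> {ta p..tb p} \<longrightarrow>
        (q has_vector_derivative (Amat p t *v q t + Bmat p t *v u t + omega p t))
          (at t within {ta p..tb p})) \<and>
     q (ta p) = qa p \<and>
     (\<forall>t. t \<notin> {ta p..tb p} \<longrightarrow> q t = 0)"

definition state ::
    "('n::finite, 'm::finite) lq_problem \<Rightarrow> (real \<Rightarrow> real^'m) \<Rightarrow> real \<Rightarrow> real^'n" where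
  "state p u = (THE q. is_state p u q)"

definition cost :: "('n::finite, 'm::finite) lq_problem \<Rightarrow> (real \<Rightarrow> real^'m) \<Rightarrow> real" where
  "cost p u =
     1/2 * ((Smat p *v (state p u (tb p) - qb p)) \<bullet> (state p u (tb p) - qb p)) +
     1/2 * integral {ta p..tb p} (\<lambda>\<tau>.
       (Wmat p \<tau> *v (state p u \<tau> - xref p \<tau>)) \<bullet> (state p u \<tau> - xref p \<tau>) +
       (Rmat p \<tau> *v (u \<tau> - vref p \<tau>)) \<bullet> (u \<tau> - vref p \<tau>))"


section \<open>Sampled-data controls\<close>

definition valid_steps :: "('n::finite, 'm::finite) lq_problem \<Rightarrow> nat \<Rightarrow> (nat \<Rightarrow> real) \<Rightarrow> bool" where
  "valid_steps p N h \<longleftrightarrow> 1 \<le> N \<and> (\<forall>i<N. 0 < h i) \<and> (\<Sum>i<N. h i) = tb p - ta p"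

definition node :: "('n::finite, 'm::finite) lq_problem \<Rightarrow> (nat \<Rightarrow> real) \<Rightarrow> nat \<Rightarrow> real" where
  "node p h i = ta p + (\<Sum>j<i. h j)"

definition sampled_controls ::
    "('n::finite, 'm::finite) lq_problem \<Rightarrow> nat \<Rightarrow> (nat \<Rightarrow> real) \<Rightarrow> (real \<Rightarrow> real^'m) set" where
  "sampled_controls p N h =
     {u. (\<forall>i<N. \<exists>c. \<forall>t\<in>{node p h i..<node p h (Suc i)}. u t = c) \<and>
         (\<forall>t. t \<notin> {ta p..<tb p} \<longrightarrow> u t = 0)}"

definition optimal_control ::
    "('n::finite, 'm::finite) lq_problem \<Rightarrow> nat \<Rightarrow> (nat \<Rightarrow> real) \<Rightarrow> real \<Rightarrow> real^'m" where
  "optimal_control p N h = (THE u. is_arg_min (cost p) (\<lambda>u. u \<in> sampled_controls p N h) u)"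

definition optimal_value ::
    "('n::finite, 'm::finite) lq_problem \<Rightarrow> nat \<Rightarrow> (nat \<Rightarrow> real) \<Rightarrow> nat \<Rightarrow> real^'m" where
  "optimal_value p N h i = optimal_control p N h (node p h i)"


section \<open>State-transition matrix and the coefficients\<close>

definition is_transition ::
    "('n::finite, 'm::finite) lq_problem \<Rightarrow> real \<Rightarrow> (real \<Rightarrow> real^'n^'n) \<Rightarrow> bool" where
  "is_transition p s \<Phi> \<longleftrightarrow>
     (\<forall>t\<in>{ta p..tb p}. (\<Phi> has_vector_derivative (Amat p t ** \<Phi> t)) (at t within {ta p..tb p})) \<and>
     \<Phi> s = mat 1 \<and>
     (\<forall>t. t \<notin> {ta p..tb p} \<longrightarrow> \<Phi> t = 0)"

text \<open>\<open>trans_mat p t s\<close> is \<open>Z(t,s)\<close>.\<close>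

definition trans_mat ::
    "('n::finite, 'm::finite) lq_problem \<Rightarrow> real \<Rightarrow> real \<Rightarrow> real^'n^'n" where
  "trans_mat p t s = (THE \<Phi>. is_transition p s \<Phi>) t"

definition beta ::
    "('n::finite, 'm::finite) lq_problem \<Rightarrow> (nat \<Rightarrow> real) \<Rightarrow> nat \<Rightarrow> real \<Rightarrow> real^'m^'n" where
  "beta p h i \<tau> = integral {node p h i..\<tau>} (\<lambda>s. trans_mat p \<tau> s ** Bmat p s)"

definition gamma ::
    "('n::finite, 'm::finite) lq_problem \<Rightarrow> (nat \<Rightarrow> real) \<Rightarrow> nat \<Rightarrow> real \<Rightarrow> real^'n" where
  "gamma p h i \<tau> = integral {node p h i..\<tau>} (\<lambda>s. trans_mat p \<tau> s *v omega p s) - xref p \<tau>"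

definition stepZ ::
    "('n::finite, 'm::finite) lq_problem \<Rightarrow> (nat \<Rightarrow> real) \<Rightarrow> nat \<Rightarrow> real^'n^'n" where
  "stepZ p h i = trans_mat p (node p h (Suc i)) (node p h i)"

definition ZB ::
    "('n::finite, 'm::finite) lq_problem \<Rightarrow> (nat \<Rightarrow> real) \<Rightarrow> nat \<Rightarrow> real^'m^'n" where
  "ZB p h i = integral {node p h i..node p h (Suc i)}
     (\<lambda>s. trans_mat p (node p h (Suc i)) s ** Bmat p s)"

definition ZOm ::
    "('n::finite, 'm::finite) lq_problem \<Rightarrow> nat \<Rightarrow> (nat \<Rightarrow> real) \<Rightarrow> nat \<Rightarrow> real^'n" where
  "ZOm p N h i = integral {node p h i..node p h (Suc i)}
       (\<lambda>s. trans_mat p (node p h (Suc i)) s *v omega p s)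
     - (if Suc i = N then qb p else 0)"

definition ZWZ ::
    "('n::finite, 'm::finite) lq_problem \<Rightarrow> (nat \<Rightarrow> real) \<Rightarrow> nat \<Rightarrow> real^'n^'n" where
  "ZWZ p h i = integral {node p h i..node p h (Suc i)}
     (\<lambda>\<tau>. transpose (trans_mat p \<tau> (node p h i)) ** Wmat p \<tau> ** trans_mat p \<tau> (node p h i))"

definition ZBWZ ::
    "('n::finite, 'm::finite) lq_problem \<Rightarrow> (nat \<Rightarrow> real) \<Rightarrow> nat \<Rightarrow> real^'n^'m" where
  "ZBWZ p h i = integral {node p h i..node p h (Suc i)}
     (\<lambda>\<tau>. transpose (beta p h i \<tau>) ** Wmat p \<tau> ** trans_mat p \<tau> (node p h i))"

definition ZBWZB ::
    "('n::finite, 'm::finite) lq_problem \<Rightarrow> (nat \<Rightarrow> real) \<Rightarrow> nat \<Rightarrow> real^'m^'m" where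
  "ZBWZB p h i = integral {node p h i..node p h (Suc i)}
     (\<lambda>\<tau>. transpose (beta p h i \<tau>) ** Wmat p \<tau> ** beta p h i \<tau>)"

definition ZBWZOmX ::
    "('n::finite, 'm::finite) lq_problem \<Rightarrow> (nat \<Rightarrow> real) \<Rightarrow> nat \<Rightarrow> real^'m" where
  "ZBWZOmX p h i = integral {node p h i..node p h (Suc i)}
     (\<lambda>\<tau>. (transpose (beta p h i \<tau>) ** Wmat p \<tau>) *v gamma p h i \<tau>)"

definition ZWZOmX ::
    "('n::finite, 'm::finite) lq_problem \<Rightarrow> (nat \<Rightarrow> real) \<Rightarrow> nat \<Rightarrow> real^'n" where
  "ZWZOmX p h i = integral {node p h i..node p h (Suc i)}
     (\<lambda>\<tau>. (transpose (trans_mat p \<tau> (node p h i)) ** Wmat p \<tau>) *v gamma p h i \<tau>)"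

definition WZOmX2 ::
    "('n::finite, 'm::finite) lq_problem \<Rightarrow> (nat \<Rightarrow> real) \<Rightarrow> nat \<Rightarrow> real" where
  "WZOmX2 p h i = integral {node p h i..node p h (Suc i)}
     (\<lambda>\<tau>. (Wmat p \<tau> *v gamma p h i \<tau>) \<bullet> gamma p h i \<tau>)"

definition Rint ::
    "('n::finite, 'm::finite) lq_problem \<Rightarrow> (nat \<Rightarrow> real) \<Rightarrow> nat \<Rightarrow> real^'m^'m" where
  "Rint p h i = integral {node p h i..node p h (Suc i)} (Rmat p)"

definition RV ::
    "('n::finite, 'm::finite) lq_problem \<Rightarrow> (nat \<Rightarrow> real) \<Rightarrow> nat \<Rightarrow> real^'m" where
  "RV p h i = integral {node p h i..node p h (Suc i)} (\<lambda>s. Rmat p s *v vref p s)"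

definition RV2 ::
    "('n::finite, 'm::finite) lq_problem \<Rightarrow> (nat \<Rightarrow> real) \<Rightarrow> nat \<Rightarrow> real" where
  "RV2 p h i = integral {node p h i..node p h (Suc i)} (\<lambda>\<tau>. (Rmat p \<tau> *v vref p \<tau>) \<bullet> vref p \<tau>)"


section \<open>Backward recursion\<close>

text \<open>The operators below give one backward step at index \<open>i\<close>; their arguments \<open>K\<close>, \<open>J\<close>, \<open>Y\<close>
  stand for \<open>K\<close>, \<open>J\<close>, \<open>Y\<close> at index \<open>i + 1\<close>.\<close>

definition Fop ::
    "('n::finite, 'm::finite) lq_problem \<Rightarrow> nat \<Rightarrow> (nat \<Rightarrow> real) \<Rightarrow> nat \<Rightarrow>
     real^'n^'n \<Rightarrow> real^'n \<Rightarrow> real \<Rightarrow> real" where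
  "Fop p N h i K J Y = (K *v ZOm p N h i) \<bullet> ZOm p N h i + WZOmX2 p h i + RV2 p h i
     + 2 * (J \<bullet> ZOm p N h i) + Y"

definition Gop ::
    "('n::finite, 'm::finite) lq_problem \<Rightarrow> nat \<Rightarrow> (nat \<Rightarrow> real) \<Rightarrow> nat \<Rightarrow>
     real^'n^'n \<Rightarrow> real^'n \<Rightarrow> real^'n" where
  "Gop p N h i K J = (transpose (stepZ p h i) ** K) *v ZOm p N h i + ZWZOmX p h i
     + transpose (stepZ p h i) *v J"

definition Hop ::
    "('n::finite, 'm::finite) lq_problem \<Rightarrow> nat \<Rightarrow> (nat \<Rightarrow> real) \<Rightarrow> nat \<Rightarrow>
     real^'n^'n \<Rightarrow> real^'n \<Rightarrow> real^'m" where
  "Hop p N h i K J = (transpose (ZB p h i) ** K) *v ZOm p N h i + ZBWZOmX p h i - RV p h i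
     + transpose (ZB p h i) *v J"

definition Pop ::
    "('n::finite, 'm::finite) lq_problem \<Rightarrow> (nat \<Rightarrow> real) \<Rightarrow> nat \<Rightarrow> real^'n^'n \<Rightarrow> real^'n^'m" where
  "Pop p h i K = transpose (ZB p h i) ** K ** stepZ p h i + ZBWZ p h i"

definition Qop ::
    "('n::finite, 'm::finite) lq_problem \<Rightarrow> (nat \<Rightarrow> real) \<Rightarrow> nat \<Rightarrow> real^'n^'n \<Rightarrow> real^'n^'n" where
  "Qop p h i K = transpose (stepZ p h i) ** K ** stepZ p h i + ZWZ p h i"

definition Top ::
    "('n::finite, 'm::finite) lq_problem \<Rightarrow> (nat \<Rightarrow> real) \<Rightarrow> nat \<Rightarrow> real^'n^'n \<Rightarrow> real^'m^'m" where
  "Top p h i K = transpose (ZB p h i) ** K ** ZB p h i + ZBWZB p h i + Rint p h i"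

function Kseq ::
    "('n::finite, 'm::finite) lq_problem \<Rightarrow> nat \<Rightarrow> (nat \<Rightarrow> real) \<Rightarrow> nat \<Rightarrow> real^'n^'n" where
  "Kseq p N h i =
     (if i < N then
        (let K = Kseq p N h (Suc i); P = Pop p h i K
         in Qop p h i K - transpose P ** matrix_inv (Top p h i K) ** P)
      else Smat p)"
  by pat_completeness auto
termination
  by (relation "Wellfounded.measure (\<lambda>(p, N, h, i). N - i)") auto

function Jseq ::
    "('n::finite, 'm::finite) lq_problem \<Rightarrow> nat \<Rightarrow> (nat \<Rightarrow> real) \<Rightarrow> nat \<Rightarrow> real^'n" where
  "Jseq p N h i =
     (if i < N then
        (let K = Kseq p N h (Suc i); J = Jseq p N h (Suc i)
         in Gop p N h i K J
            - (transpose (Pop p h i K) ** matrix_inv (Top p h i K)) *v Hop p N h i K J)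
      else 0)"
  by pat_completeness auto
termination
  by (relation "Wellfounded.measure (\<lambda>(p, N, h, i). N - i)") auto

function Yseq ::
    "('n::finite, 'm::finite) lq_problem \<Rightarrow> nat \<Rightarrow> (nat \<Rightarrow> real) \<Rightarrow> nat \<Rightarrow> real" where
  "Yseq p N h i =
     (if i < N then
        (let K = Kseq p N h (Suc i); J = Jseq p N h (Suc i); H = Hop p N h i K J
         in Fop p N h i K J (Yseq p N h (Suc i)) - (matrix_inv (Top p h i K) *v H) \<bullet> H)
      else 0)"
  by pat_completeness auto
termination
  by (relation "Wellfounded.measure (\<lambda>(p, N, h, i). N - i)") auto

declare Kseq.simps [simp del] Jseq.simps [simp del] Yseq.simps [simp del]

definition Pmat ::
    "('n::finite, 'm::finite) lq_problem \<Rightarrow> nat \<Rightarrow> (nat \<Rightarrow> real) \<Rightarrow> nat \<Rightarrow> real^'n^'m" where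
  "Pmat p N h i = Pop p h i (Kseq p N h (Suc i))"

definition Tmat ::
    "('n::finite, 'm::finite) lq_problem \<Rightarrow> nat \<Rightarrow> (nat \<Rightarrow> real) \<Rightarrow> nat \<Rightarrow> real^'m^'m" where
  "Tmat p N h i = Top p h i (Kseq p N h (Suc i))"

definition Hvec ::
    "('n::finite, 'm::finite) lq_problem \<Rightarrow> nat \<Rightarrow> (nat \<Rightarrow> real) \<Rightarrow> nat \<Rightarrow> real^'m" where
  "Hvec p N h i = Hop p N h i (Kseq p N h (Suc i)) (Jseq p N h (Suc i))"

end

(* Let V_i(z) = <K_i z, z> + 2 <J_i, z> + Y_i. Variation of constants makes both the state at s_(i+1)
   and the running cost on [s_i, s_(i+1)] explicit in the state y at s_i and the control value c
   there, and the recursion for K, J, Y is what completing the square in c produces: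

     running cost + V_(i+1)(next state) = V_i(y) + <T_i w, w>,   w = c + T_i^(-1) (P_i y + H_i).

   Telescoping gives 2 C(u) = V_0(q_a) + sum_i <T_i w_i, w_i>. As every T_i is positive definite,
   the unique minimiser is the control with all w_i = 0, which the closed-loop recursion yields.

   The state exists and is unique because the flow of A is given by a Picard series with an inverse
   Psi, and Psi times the difference of two states is absolutely continuous with derivative zero
   almost everywhere, hence constant. *)
theory Submission
  imports Defs
begin

section \<open>Bilinear matrix operations\<close>

text \<open>A state satisfies its equation only almost everywhere, and a competing solution may
  violate it on any null set. This is why absolute continuity is developed at length: the
  exceptional set has to be absorbed by the \<open>\<delta>\<close> of that definition.

  The factorisation of the transition matrix as \<open>\<Phi> t ** \<Psi> s\<close> separates its
  two time variables. Integrals whose kernel depends on their upper limit become a matrix function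
  times an ordinary primitive, hence continuous in that limit.

  Invertibility of T_i rests on K_(i+1) being positive semidefinite, which cannot be read off from
  the difference in the recursion. K_i is a Schur complement: its form at y is the value, at the
  minimising c, of a nonnegative quadratic form in the pair (y, c).

  The term - q_b hidden in the last \<open>ZOm\<close> makes the terminal cost fit the general
  pattern: V_N is evaluated at q(b) - q_b.

  The cost identity holds for every sampled control, so it delivers existence and uniqueness of the
  minimiser together, as the description operator in \<open>optimal_control\<close> demands.\<close>

lemma matrix_add_rdistrib:
  fixes A B :: "real^'n^'m" and C :: "real^'k^'n"
  shows "(A + B) ** C = A ** C + B ** C"
  by (simp add: matrix_matrix_mult_def vec_eq_iff sum.distrib[symmetric] distrib_right)

text \<open>Bilinear maps between finite-dimensional spaces are bounded. In this form the matrix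
  product inherits continuity, the product rule and the existence lemma for linear
  equations.\<close>

lemma bounded_bilinear_matrix_mult:
  "bounded_bilinear ((**) :: real^'n^'m \<Rightarrow> real^'k^'n \<Rightarrow> real^'k^'m)"
  by (simp add: bilinear_conv_bounded_bilinear[symmetric] bilinear_def linear_iff
      matrix_add_ldistrib matrix_add_rdistrib scalar_matrix_assoc matrix_scalar_ac)

lemma bounded_bilinear_matrix_vector_mult:
  "bounded_bilinear ((*v) :: real^'n^'m \<Rightarrow> real^'n \<Rightarrow> real^'m)"
  by (simp add: bilinear_conv_bounded_bilinear[symmetric] bilinear_def linear_iff
      algebra_simps scaleR_matrix_vector_assoc matrix_vector_mult_scaleR)

lemma bounded_linear_transpose: "bounded_linear (transpose :: real^'n^'m \<Rightarrow> real^'m^'n)"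
  by (intro linear_conv_bounded_linear[THEN iffD1] linearI)
     (simp_all add: transpose_def vec_eq_iff)

lemmas continuous_on_matrix_mult =
  bounded_bilinear.continuous_on[OF bounded_bilinear_matrix_mult]
lemmas continuous_on_matrix_vector_mult =
  bounded_bilinear.continuous_on[OF bounded_bilinear_matrix_vector_mult]
lemmas continuous_on_transpose = bounded_linear.continuous_on[OF bounded_linear_transpose]

lemma inner_matrix_transpose:
  fixes M :: "real^'n^'m"
  shows "(transpose M *v x) \<bullet> y = x \<bullet> (M *v y)"
  by (simp add: dot_lmul_matrix)

section \<open>Linear differential equations with continuous coefficients\<close>

text \<open>One Picard integration raises the power and the factorial together; this is the
  induction step behind the exponential majorant.\<close>

lemma integral_pow_bound:
  fixes a t :: real
  assumes "a \<le> t"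
  shows "((\<lambda>s. c * (s - a) ^ n / fact n) has_integral c * (t - a) ^ Suc n / fact (Suc n)) {a..t}"
proof -
  have "((\<lambda>s. c * (s - a) ^ Suc n / fact (Suc n)) has_vector_derivative c * (s - a) ^ n / fact n)
      (at s within {a..t})" for s
  proof -
    have "((\<lambda>s. (s - a) ^ Suc n) has_real_derivative real (Suc n) * (s - a) ^ n) (at s within {a..t})"
      by (auto intro!: derivative_eq_intros simp del: power_Suc)
    from DERIV_cmult[OF this, of "c / fact (Suc n)"] show ?thesis
      unfolding has_real_derivative_iff_has_vector_derivative[symmetric]
      by (simp add: field_simps del: of_nat_Suc power_Suc)
  qed
  from fundamental_theorem_of_calculus[OF assms this] show ?thesis by simp
qed

text \<open>Picard series; its terms are bounded by those of an exponential series.\<close>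

lemma linear_ode_exists:
  fixes op :: "'c::real_normed_vector \<Rightarrow> 'a::banach \<Rightarrow> 'a"
  assumes op: "bounded_bilinear op" and A: "continuous_on {a..b::real} A" and ab: "a \<le> b"
  shows "\<exists>x. x a = x0 \<and>
    (\<forall>t\<in>{a..b}. (x has_vector_derivative op (A t) (x t)) (at t within {a..b}))"
proof -
  interpret bounded_bilinear op by (rule op)
  obtain K where K: "K > 0" "\<And>c y. norm (op c y) \<le> norm c * norm y * K"
    using pos_bounded by blast
  obtain M0 where M0: "\<And>t. t \<in> {a..b} \<Longrightarrow> norm (A t) \<le> M0"
    using compact_imp_bounded[OF compact_continuous_image[OF A compact_Icc]]
    unfolding bounded_iff by blast
  have "0 \<le> M0" using M0[of a] ab norm_ge_zero[of "A a"] by (simp del: norm_ge_zero)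
  define M where "M = M0 * K"
  have M: "0 \<le> M" using \<open>0 \<le> M0\<close> K(1) by (simp add: M_def)
  have op_le: "norm (op (A t) y) \<le> M * norm y" if "t \<in> {a..b}" for t y
  proof -
    have "norm (op (A t) y) \<le> norm (A t) * norm y * K" by (rule K)
    also have "\<dots> \<le> M0 * norm y * K"
      using M0[OF that] K(1) by (intro mult_right_mono) auto
    finally show ?thesis by (simp add: M_def mult_ac)
  qed
  \<comment> \<open>\<open>D n\<close> is the difference of consecutive Picard iterates, so the
    iterates themselves are the partial sums.\<close>
  define D where "D = rec_nat (\<lambda>t::real. x0) (\<lambda>n d t. integral {a..t} (\<lambda>s. op (A s) (d s)))"
  have D0: "D 0 = (\<lambda>t. x0)" and
    DS: "\<And>n. D (Suc n) = (\<lambda>t. integral {a..t} (\<lambda>s. op (A s) (D n s)))"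
    by (simp_all add: D_def)
  have Dcont: "continuous_on {a..b} (D n)" for n
  proof (induction n)
    case 0 then show ?case by (simp add: D0)
  next
    case (Suc n)
    show ?case unfolding DS
      by (intro indefinite_integral_continuous_1 integrable_continuous_real continuous_on A Suc)
  qed
  have Dcont': "continuous_on {a..t} (\<lambda>s. op (A s) (D n s))" if "t \<le> b" for n t
    using that by (intro continuous_on[OF continuous_on_subset[OF A] continuous_on_subset[OF Dcont]]) auto
  have Dbd: "norm (D n t) \<le> (norm x0 * M ^ n) * (t - a) ^ n / fact n" if "t \<in> {a..b}" for n t
    using that
  proof (induction n arbitrary: t)
    case 0 then show ?case by (simp add: D0)
  next
    case (Suc n)
    have "norm (D (Suc n) t) \<le>
        integral {a..t} (\<lambda>s. (norm x0 * M ^ Suc n) * (s - a) ^ n / fact n)"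
      unfolding DS
    proof (rule integral_norm_bound_integral)
      show "(\<lambda>s. op (A s) (D n s)) integrable_on {a..t}"
        using Suc.prems by (intro integrable_continuous_real Dcont') auto
      show "(\<lambda>s. (norm x0 * M ^ Suc n) * (s - a) ^ n / fact n) integrable_on {a..t}"
        by (intro integrable_continuous_real continuous_intros) auto
      fix s assume s: "s \<in> {a..t}"
      then have s': "s \<in> {a..b}" using Suc.prems by auto
      have "norm (op (A s) (D n s)) \<le> M * norm (D n s)" by (rule op_le[OF s'])
      also have "\<dots> \<le> M * ((norm x0 * M ^ n) * (s - a) ^ n / fact n)"
        by (intro mult_left_mono Suc.IH s' M)
      finally show "norm (op (A s) (D n s)) \<le> (norm x0 * M ^ Suc n) * (s - a) ^ n / fact n"
        by (simp add: mult_ac)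
    qed
    also have "\<dots> = (norm x0 * M ^ Suc n) * (t - a) ^ Suc n / fact (Suc n)"
      using Suc.prems by (intro integral_unique integral_pow_bound) auto
    finally show ?case .
  qed
  define B where "B n = norm x0 * (inverse (fact n) * (M * (b - a)) ^ n)" for n
  have Bsum: "summable B"
    unfolding B_def by (intro summable_mult summable_exp)
  have DB: "norm (D n t) \<le> B n" if t: "t \<in> {a..b}" for n t
  proof -
    have "norm (D n t) \<le> (norm x0 * M ^ n) * (t - a) ^ n / fact n" by (rule Dbd[OF t])
    also have "\<dots> \<le> (norm x0 * M ^ n) * (b - a) ^ n / fact n"
      using t M by (intro divide_right_mono mult_left_mono power_mono) auto
    also have "\<dots> = B n" by (simp add: B_def power_mult_distrib divide_inverse mult_ac)
    finally show ?thesis .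
  qed
  define x where "x t = (\<Sum>n. D n t)" for t
  have unif: "uniform_limit {a..b} (\<lambda>n t. \<Sum>i<n. D i t) x sequentially"
    unfolding x_def by (rule Weierstrass_m_test[OF DB Bsum])
  have S_cont: "continuous_on {a..b} (\<lambda>t. \<Sum>i<n. D i t)" for n
    by (intro continuous_on_sum Dcont)
  have x_cont: "continuous_on {a..b} x"
    by (rule uniform_limit_theorem[OF _ unif]) (simp_all add: S_cont)
  have x_eq: "x t = x0 + integral {a..t} (\<lambda>s. op (A s) (x s))" if t: "t \<in> {a..b}" for t
  proof -
    have sub: "{a..t} \<subseteq> {a..b}" using t by auto
    \<comment> \<open>The Picard iteration for partial sums. Both sides converge, the right one by
      uniform convergence of the integrands, and the limit is the integral equation for
      \<open>x\<close>.\<close>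
    have S_Suc: "(\<Sum>i<Suc n. D i t) = x0 + integral {a..t} (\<lambda>s. op (A s) (\<Sum>i<n. D i s))" for n
    proof -
      have "(\<Sum>i<Suc n. D i t) = x0 + (\<Sum>i<n. integral {a..t} (\<lambda>s. op (A s) (D i s)))"
        by (subst sum.lessThan_Suc_shift) (simp add: D0 DS)
      also have "(\<Sum>i<n. integral {a..t} (\<lambda>s. op (A s) (D i s))) =
          integral {a..t} (\<lambda>s. \<Sum>i<n. op (A s) (D i s))"
        using t by (intro integral_sum[symmetric] integrable_continuous_real Dcont') auto
      finally show ?thesis by (simp add: sum_right)
    qed
    have unif_op: "uniform_limit {a..t} (\<lambda>n s. op (A s) (\<Sum>i<n. D i s)) (\<lambda>s. op (A s) (x s))
        sequentially"
    proof (rule bounded_uniform_limit)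
      show "uniform_limit {a..t} (\<lambda>n. A) A sequentially" by (rule uniform_limit_const)
      show "uniform_limit {a..t} (\<lambda>n s. \<Sum>i<n. D i s) x sequentially"
        by (rule uniform_limit_on_subset[OF unif sub])
      show "bounded (A ` {a..t})"
        by (rule bounded_subset[of "A ` {a..b}"])
          (use sub A in \<open>auto intro: compact_imp_bounded compact_continuous_image\<close>)
      show "bounded (x ` {a..t})"
        by (rule bounded_subset[of "x ` {a..b}"])
          (use sub x_cont in \<open>auto intro: compact_imp_bounded compact_continuous_image\<close>)
    qed
    have S_op_cont: "continuous_on {a..t} (\<lambda>s. op (A s) (\<Sum>i<n. D i s))" for n
      by (rule continuous_on[OF continuous_on_subset[OF A sub] continuous_on_subset[OF S_cont sub]])
    have "(\<lambda>n. integral {a..t} (\<lambda>s. op (A s) (\<Sum>i<n. D i s))) \<longlonglongrightarrow>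
        integral {a..t} (\<lambda>s. op (A s) (x s))"
    proof -
      obtain I J where IJ: "\<And>n. ((\<lambda>s. op (A s) (\<Sum>i<n. D i s)) has_integral I n) {a..t}"
        "((\<lambda>s. op (A s) (x s)) has_integral J) {a..t}" "(I \<longlongrightarrow> J) sequentially"
        by (rule uniform_limit_integral[OF unif_op S_op_cont sequentially_bot]) blast
      have "integral {a..t} (\<lambda>s. op (A s) (\<Sum>i<n. D i s)) = I n" for n
        using IJ(1) by (rule integral_unique)
      moreover have "integral {a..t} (\<lambda>s. op (A s) (x s)) = J"
        using IJ(2) by (rule integral_unique)
      ultimately show ?thesis using IJ(3) by simp
    qed
    then have "(\<lambda>n. \<Sum>i<Suc n. D i t) \<longlonglongrightarrow> x0 + integral {a..t} (\<lambda>s. op (A s) (x s))"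
      unfolding S_Suc by (intro tendsto_intros)
    moreover have "(\<lambda>n. \<Sum>i<Suc n. D i t) \<longlonglongrightarrow> x t"
      using tendsto_uniform_limitI[OF unif t] by (rule LIMSEQ_Suc)
    ultimately show ?thesis by (rule LIMSEQ_unique[symmetric])
  qed
  have "(x has_vector_derivative op (A t) (x t)) (at t within {a..b})" if t: "t \<in> {a..b}" for t
  proof (rule has_vector_derivative_transform[OF t x_eq])
    have "continuous_on {a..b} (\<lambda>s. op (A s) (x s))"
      by (intro continuous_on A x_cont)
    from has_vector_derivative_add[OF has_vector_derivative_const integral_has_vector_derivative[OF this t]]
    show "((\<lambda>t. x0 + integral {a..t} (\<lambda>s. op (A s) (x s))) has_vector_derivative op (A t) (x t))
        (at t within {a..b})"
      by simp
  qed
  moreover have "x a = x0" using x_eq[of a] ab by simp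
  ultimately show ?thesis by blast
qed

section \<open>Absolutely continuous functions\<close>

text \<open>A common source for the closure properties: products, differences, Lipschitz functions
  and extensions by zero all have increments bounded by those of two absolutely continuous functions
  plus a Lipschitz term.\<close>

lemma abs_continuous_on_dominated:
  fixes f :: "real \<Rightarrow> 'a::real_normed_vector" and d1 :: "real \<Rightarrow> 'b::real_normed_vector"
    and d2 :: "real \<Rightarrow> 'c::real_normed_vector"
  assumes d1: "abs_continuous_on a b d1" and d2: "abs_continuous_on a b d2"
    and le: "\<And>l r. a \<le> l \<Longrightarrow> l \<le> r \<Longrightarrow> r \<le> b \<Longrightarrow>
      norm (f r - f l) \<le> M * (norm (d1 r - d1 l) + norm (d2 r - d2 l)) + L * (r - l)"
  shows "abs_continuous_on a b f"
  unfolding abs_continuous_on_def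
proof (intro allI impI)
  fix \<epsilon> :: real assume \<epsilon>: "\<epsilon> > 0"
  \<comment> \<open>The maximum with 1 makes \<open>C\<close> positive whatever \<open>M\<close> and
    \<open>L\<close> are, so that \<open>\<epsilon>\<close> can be shared out in three parts
    \<open>\<epsilon> / (3 * C)\<close>.\<close>
  define C where "C = max 1 (max M L)"
  have C: "C > 0" "M \<le> C" "L \<le> C" by (auto simp: C_def)
  have \<epsilon>': "\<epsilon> / (3 * C) > 0" using \<epsilon> C by simp
  obtain \<delta>1 where \<delta>1: "\<delta>1 > 0" "\<And>(k::nat) (l::nat \<Rightarrow> real) r.
      (\<forall>j<k. a \<le> l j \<and> l j \<le> r j \<and> r j \<le> b) \<and>
        disjoint_family_on (\<lambda>j. {l j<..<r j}) {..<k} \<and> (\<Sum>j<k. r j - l j) < \<delta>1 \<Longrightarrow>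
        (\<Sum>j<k. norm (d1 (r j) - d1 (l j))) < \<epsilon> / (3 * C)"
    using d1 \<epsilon>' unfolding abs_continuous_on_def by blast
  obtain \<delta>2 where \<delta>2: "\<delta>2 > 0" "\<And>(k::nat) (l::nat \<Rightarrow> real) r.
      (\<forall>j<k. a \<le> l j \<and> l j \<le> r j \<and> r j \<le> b) \<and>
        disjoint_family_on (\<lambda>j. {l j<..<r j}) {..<k} \<and> (\<Sum>j<k. r j - l j) < \<delta>2 \<Longrightarrow>
        (\<Sum>j<k. norm (d2 (r j) - d2 (l j))) < \<epsilon> / (3 * C)"
    using d2 \<epsilon>' unfolding abs_continuous_on_def by blast
  define \<delta> where "\<delta> = min (min \<delta>1 \<delta>2) (\<epsilon> / (3 * C))"
  show "\<exists>\<delta>>0. \<forall>(k::nat) (l::nat \<Rightarrow> real) r.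
      (\<forall>j<k. a \<le> l j \<and> l j \<le> r j \<and> r j \<le> b) \<and>
        disjoint_family_on (\<lambda>j. {l j<..<r j}) {..<k} \<and> (\<Sum>j<k. r j - l j) < \<delta> \<longrightarrow>
        (\<Sum>j<k. norm (f (r j) - f (l j))) < \<epsilon>"
  proof (intro exI[of _ \<delta>] conjI allI impI; (elim conjE)?)
    show "\<delta> > 0" using \<delta>1(1) \<delta>2(1) \<epsilon>' by (simp add: \<delta>_def)
    fix k :: nat and l r :: "nat \<Rightarrow> real"
    assume lr: "\<forall>j<k. a \<le> l j \<and> l j \<le> r j \<and> r j \<le> b"
      and dis: "disjoint_family_on (\<lambda>j. {l j<..<r j}) {..<k}"
      and small: "(\<Sum>j<k. r j - l j) < \<delta>"
    let ?s1 = "\<Sum>j<k. norm (d1 (r j) - d1 (l j))" and ?s2 = "\<Sum>j<k. norm (d2 (r j) - d2 (l j))"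
    have s1: "?s1 < \<epsilon> / (3 * C)" using lr dis small by (intro \<delta>1(2)) (auto simp: \<delta>_def)
    have s2: "?s2 < \<epsilon> / (3 * C)" using lr dis small by (intro \<delta>2(2)) (auto simp: \<delta>_def)
    have s3: "(\<Sum>j<k. r j - l j) < \<epsilon> / (3 * C)" using small by (simp add: \<delta>_def)
    have "(\<Sum>j<k. norm (f (r j) - f (l j))) \<le>
        (\<Sum>j<k. C * (norm (d1 (r j) - d1 (l j)) + norm (d2 (r j) - d2 (l j)) + (r j - l j)))"
    proof (rule sum_mono)
      fix j assume "j \<in> {..<k}"
      then have j: "a \<le> l j" "l j \<le> r j" "r j \<le> b" using lr by auto
      have "norm (f (r j) - f (l j)) \<le>
          M * (norm (d1 (r j) - d1 (l j)) + norm (d2 (r j) - d2 (l j))) + L * (r j - l j)"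
        by (rule le[OF j])
      also have "\<dots> \<le> C * (norm (d1 (r j) - d1 (l j)) + norm (d2 (r j) - d2 (l j))) + C * (r j - l j)"
        using C j by (intro add_mono mult_right_mono) auto
      finally show "norm (f (r j) - f (l j)) \<le>
          C * (norm (d1 (r j) - d1 (l j)) + norm (d2 (r j) - d2 (l j)) + (r j - l j))"
        by (simp add: distrib_left)
    qed
    also have "\<dots> = C * (?s1 + ?s2 + (\<Sum>j<k. r j - l j))"
      by (simp only: sum.distrib sum_distrib_left[symmetric])
    also have "\<dots> < C * (\<epsilon> / (3 * C) + \<epsilon> / (3 * C) + \<epsilon> / (3 * C))"
      using s1 s2 s3 C by (intro mult_strict_left_mono) auto
    also have "\<dots> = \<epsilon>" using C by simp
    finally show "(\<Sum>j<k. norm (f (r j) - f (l j))) < \<epsilon>" .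
  qed
qed

lemma abs_continuous_on_const: "abs_continuous_on a b (\<lambda>_. c)"
  by (auto simp: abs_continuous_on_def intro: exI[of _ 1])

lemma abs_continuous_on_lipschitz:
  assumes "\<And>l r. a \<le> l \<Longrightarrow> l \<le> r \<Longrightarrow> r \<le> b \<Longrightarrow> norm (f r - f l) \<le> L * (r - l)"
  shows "abs_continuous_on a b f"
  using assms
  by (intro abs_continuous_on_dominated[OF abs_continuous_on_const abs_continuous_on_const,
        where M = 0 and L = L]) auto

lemma abs_continuous_on_subset:
  assumes "abs_continuous_on a b f" "a \<le> c" "d \<le> b"
  shows "abs_continuous_on c d f"
  unfolding abs_continuous_on_def
proof (intro allI impI)
  fix \<epsilon> :: real assume "\<epsilon> > 0"
  then obtain \<delta> where \<delta>: "\<delta> > 0" "\<And>(k::nat) (l::nat \<Rightarrow> real) r.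
      (\<forall>j<k. a \<le> l j \<and> l j \<le> r j \<and> r j \<le> b) \<and>
        disjoint_family_on (\<lambda>j. {l j<..<r j}) {..<k} \<and> (\<Sum>j<k. r j - l j) < \<delta> \<Longrightarrow>
        (\<Sum>j<k. norm (f (r j) - f (l j))) < \<epsilon>"
    using assms(1) unfolding abs_continuous_on_def by blast
  show "\<exists>\<delta>>0. \<forall>(k::nat) (l::nat \<Rightarrow> real) r.
      (\<forall>j<k. c \<le> l j \<and> l j \<le> r j \<and> r j \<le> d) \<and>
        disjoint_family_on (\<lambda>j. {l j<..<r j}) {..<k} \<and> (\<Sum>j<k. r j - l j) < \<delta> \<longrightarrow>
        (\<Sum>j<k. norm (f (r j) - f (l j))) < \<epsilon>"
  proof (intro exI[of _ \<delta>] conjI allI impI)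
    show "\<delta> > 0" by (rule \<delta>(1))
    fix k :: nat and l r :: "nat \<Rightarrow> real"
    assume lr: "(\<forall>j<k. c \<le> l j \<and> l j \<le> r j \<and> r j \<le> d) \<and>
        disjoint_family_on (\<lambda>j. {l j<..<r j}) {..<k} \<and> (\<Sum>j<k. r j - l j) < \<delta>"
    have "\<forall>j<k. a \<le> l j \<and> l j \<le> r j \<and> r j \<le> b"
      using lr assms(2,3) by force
    then show "(\<Sum>j<k. norm (f (r j) - f (l j))) < \<epsilon>"
      using lr by (intro \<delta>(2)) blast
  qed
qed

text \<open>A tagged division, fine with respect to a gauge that forces the intervals tagged in the
  exceptional null set into a small open neighbourhood of it, bounds the total increment.\<close>

lemma abs_continuous_on_deriv_zero:
  fixes f :: "real \<Rightarrow> 'a::real_normed_vector"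
  assumes ac: "abs_continuous_on a b f" and ab: "a \<le> b" and E: "negligible E"
    and der: "\<And>t. t \<in> {a..b} - E \<Longrightarrow> (f has_vector_derivative 0) (at t within {a..b})"
  shows "f b = f a"
proof -
  have small: "norm (f b - f a) \<le> \<epsilon> * (b - a) + \<epsilon>" if \<epsilon>: "\<epsilon> > 0" for \<epsilon>
  proof -
    obtain \<delta> where \<delta>: "\<delta> > 0" "\<And>(k::nat) (l::nat \<Rightarrow> real) r.
        (\<forall>j<k. a \<le> l j \<and> l j \<le> r j \<and> r j \<le> b) \<and>
          disjoint_family_on (\<lambda>j. {l j<..<r j}) {..<k} \<and> (\<Sum>j<k. r j - l j) < \<delta> \<Longrightarrow>
          (\<Sum>j<k. norm (f (r j) - f (l j))) < \<epsilon>"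
      using ac \<epsilon> unfolding abs_continuous_on_def by blast
    have Em: "E \<in> sets lebesgue" "E \<in> null_sets lebesgue"
      using E by (auto simp: negligible_iff_null_sets)
    obtain U where U: "open U" "E \<subseteq> U" "U - E \<in> lmeasurable"
        "emeasure lebesgue (U - E) < ennreal \<delta>"
      using sets_lebesgue_outer_open[OF Em(1) \<delta>(1)] by blast
    \<comment> \<open>Outer regularity controls \<open>U - E\<close>; as \<open>E\<close> is null,
      the bound passes to \<open>U\<close> itself.\<close>
    have Uem: "emeasure lebesgue U < ennreal \<delta>"
      using U(1,4) emeasure_Diff_null_set[OF Em(2), of U] by auto
    then have Ulm: "U \<in> lmeasurable"
      using U(1) by (auto simp: fmeasurable_def less_top intro: order_less_trans ennreal_less_top)
    have Um: "measure lebesgue U < \<delta>"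
      using Uem Ulm \<delta>(1) by (simp add: emeasure_eq_measure2 ennreal_less_iff)
    have "\<exists>d>0. \<forall>y\<in>{a..b}. norm (y - x) < d \<longrightarrow> norm (f y - f x) \<le> \<epsilon> * norm (y - x)"
      if "x \<in> {a..b} - E" for x
      using der[OF that] \<epsilon> unfolding has_vector_derivative_def has_derivative_within_alt by simp
    then obtain d where d: "\<And>x. x \<in> {a..b} - E \<Longrightarrow> d x > 0"
        "\<And>x y. x \<in> {a..b} - E \<Longrightarrow> y \<in> {a..b} \<Longrightarrow> norm (y - x) < d x \<Longrightarrow>
          norm (f y - f x) \<le> \<epsilon> * norm (y - x)"
      by metis
    \<comment> \<open>The value \<open>U\<close> at points of \<open>E\<close> confines every
      interval tagged there to \<open>U\<close>. The radius \<open>d x\<close> comes from the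
      vanishing derivative, and \<open>ball x 1\<close> is only a default, since a gauge is
      total.\<close>
    define g where "g x = (if x \<in> E then U else if x \<in> {a..b} then ball x (d x) else ball x 1)" for x
    have "gauge g" using U(1,2) d(1) by (auto simp: gauge_def g_def)
    then obtain p where p: "p tagged_division_of {a..b}" "g fine p"
      by (rule fine_division_exists_real)
    have finp: "finite p" using p(1) by (rule tagged_division_of_finite)
    have iv: "\<exists>l r. K = {l..r} \<and> l \<le> x \<and> x \<le> r \<and> a \<le> l \<and> r \<le> b \<and> K \<subseteq> g x"
      if xKp: "(x, K) \<in> p" for x K
    proof -
      obtain l r where lr: "K = cbox l r" using tagged_division_ofD(4)[OF p(1) xKp] by blast
      have "x \<in> K" "K \<subseteq> {a..b}" using tagged_division_ofD(2,3)[OF p(1) that] by auto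
      moreover have "K \<subseteq> g x" using fineD[OF p(2) that] .
      ultimately show ?thesis using lr by (intro exI[of _ l] exI[of _ r]) auto
    qed
    define pE where "pE = {xK \<in> p. fst xK \<in> E}"
    define F where "F xK = norm (f (Sup (snd xK)) - f (Inf (snd xK)))" for xK :: "real \<times> real set"
    have "f b - f a = (\<Sum>(x,K)\<in>p. f (Sup K) - f (Inf K))"
      using additive_tagged_division_1[OF ab p(1), of f] by simp
    also have "norm \<dots> \<le> (\<Sum>xK\<in>p. F xK)"
      by (rule order_trans[OF norm_sum]) (simp add: F_def case_prod_beta)
    also have "\<dots> = (\<Sum>xK\<in>p - pE. F xK) + (\<Sum>xK\<in>pE. F xK)"
      using finp by (intro sum.subset_diff) (auto simp: pE_def)
    also have "(\<Sum>xK\<in>p - pE. F xK) \<le> \<epsilon> * (b - a)"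
    proof -
      have "(\<Sum>xK\<in>p - pE. F xK) \<le> (\<Sum>xK\<in>p - pE. \<epsilon> * measure lborel (snd xK))"
      proof (rule sum_mono)
        fix xK assume xK: "xK \<in> p - pE"
        obtain x K where [simp]: "xK = (x, K)" by force
        have xp: "(x, K) \<in> p" "x \<notin> E" using xK by (auto simp: pE_def)
        obtain l r where lr: "K = {l..r}" "l \<le> x" "x \<le> r" "a \<le> l" "r \<le> b" "K \<subseteq> g x"
          using iv[OF xp(1)] by blast
        have x: "x \<in> {a..b} - E" using lr xp by auto
        have "l \<in> g x" "r \<in> g x" using lr by auto
        then have "norm (l - x) < d x" "norm (r - x) < d x"
          using x by (auto simp: g_def dist_real_def)
        \<comment> \<open>Both ends are compared with the tag. As \<open>l \<le> x \<le> r\<close>,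
          the two distances add up to exactly \<open>r - l\<close>.\<close>
        then have "norm (f l - f x) \<le> \<epsilon> * norm (l - x)" "norm (f r - f x) \<le> \<epsilon> * norm (r - x)"
          using d(2)[OF x, of l] d(2)[OF x, of r] lr by (simp_all del: real_norm_def)
        then have "norm (f r - f l) \<le> \<epsilon> * norm (r - x) + \<epsilon> * norm (l - x)"
          using norm_triangle_ineq4[of "f r - f x" "f l - f x"] by simp
        also have "\<dots> = \<epsilon> * (r - l)" using lr by (simp add: algebra_simps)
        finally show "F xK \<le> \<epsilon> * measure lborel (snd xK)"
          using lr by (simp add: F_def)
      qed
      also have "\<dots> \<le> (\<Sum>xK\<in>p. \<epsilon> * measure lborel (snd xK))"
        using finp \<epsilon> by (intro sum_mono2) auto
      also have "\<dots> = \<epsilon> * (\<Sum>(x,K)\<in>p. measure lborel K)"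
        by (simp add: sum_distrib_left case_prod_beta)
      also have "(\<Sum>(x,K)\<in>p. measure lborel K) = b - a"
        using additive_content_tagged_division[of p a b] p(1) ab by simp
      finally show ?thesis .
    qed
    also have "(\<Sum>xK\<in>pE. F xK) \<le> \<epsilon>"
    proof -
      have fin: "finite pE" using finp by (simp add: pE_def)
      \<comment> \<open>Absolute continuity speaks of families indexed by an initial segment of the
        naturals, so the intervals tagged in \<open>E\<close> are enumerated and their ends
        recovered as \<open>Inf\<close> and \<open>Sup\<close>.\<close>
      obtain \<phi> where \<phi>: "bij_betw \<phi> {..<card pE} pE"
        using ex_bij_betw_nat_finite[OF fin] by (auto simp: atLeast0LessThan)
      define l r where "l j = Inf (snd (\<phi> j))" and "r j = Sup (snd (\<phi> j))" for j
      have \<phi>p: "\<phi> j \<in> p" "fst (\<phi> j) \<in> E" if "j < card pE" for j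
        using bij_betwE[OF \<phi>] that by (auto simp: pE_def)
      have lr: "snd (\<phi> j) = {l j..r j} \<and> a \<le> l j \<and> l j \<le> r j \<and> r j \<le> b \<and> {l j..r j} \<subseteq> U"
        if "j < card pE" for j
      proof -
        obtain x K where xK: "\<phi> j = (x, K)" by force
        have 1: "(x, K) \<in> p" "x \<in> E" using \<phi>p[OF that] xK by auto
        obtain l' r' where "K = {l'..r'}" "l' \<le> x" "x \<le> r'" "a \<le> l'" "r' \<le> b" "K \<subseteq> g x"
          using iv[OF 1(1)] by blast
        then show ?thesis using 1(2) xK by (simp add: l_def r_def g_def)
      qed
      have dis: "disjoint_family_on (\<lambda>j. {l j<..<r j}) {..<card pE}"
        unfolding disjoint_family_on_def
      proof (intro ballI impI)
        fix i j assume ij: "i \<in> {..<card pE}" "j \<in> {..<card pE}" "i \<noteq> j"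
        then have "\<phi> i \<noteq> \<phi> j" using \<phi> by (auto simp: bij_betw_def inj_on_def)
        moreover have "(fst (\<phi> i), snd (\<phi> i)) \<in> p" "(fst (\<phi> j), snd (\<phi> j)) \<in> p"
          using \<phi>p ij by auto
        ultimately have "interior (snd (\<phi> i)) \<inter> interior (snd (\<phi> j)) = {}"
          using tagged_division_ofD(5)[OF p(1)] by (metis prod.collapse)
        then show "{l i<..<r i} \<inter> {l j<..<r j} = {}"
          using lr ij by (simp add: interior_atLeastAtMost_real)
      qed
      \<comment> \<open>By disjointness the total length is the measure of a union contained in
        \<open>U\<close>, hence below \<open>\<delta>\<close>.\<close>
      have "(\<Sum>j<card pE. r j - l j) = (\<Sum>j<card pE. measure lebesgue {l j<..<r j})"
        using lr by (intro sum.cong) auto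
      also have "\<dots> = measure lebesgue (\<Union>j<card pE. {l j<..<r j})"
        using dis lr by (intro measure_finite_Union[symmetric]) (simp_all add: image_subset_iff)
      also have "\<dots> \<le> measure lebesgue U"
      proof (rule measure_mono_fmeasurable[OF _ _ Ulm])
        show "(\<Union>j<card pE. {l j<..<r j}) \<subseteq> U"
          using lr by (intro UN_least) (meson greaterThanLessThan_subseteq_atLeastAtMost_iff lessThan_iff order_refl order_trans)
      qed auto
      finally have "(\<Sum>j<card pE. r j - l j) < \<delta>" using Um by simp
      then have "(\<Sum>j<card pE. norm (f (r j) - f (l j))) < \<epsilon>"
        using dis lr by (intro \<delta>(2)) auto
      moreover have "(\<Sum>xK\<in>pE. F xK) = (\<Sum>j<card pE. norm (f (r j) - f (l j)))"
        using sum.reindex_bij_betw[OF \<phi>, of F] by (simp add: F_def l_def r_def)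
      ultimately show ?thesis by simp
    qed
    finally show ?thesis by simp
  qed
  have "norm (f b - f a) \<le> 0"
  proof (rule field_le_epsilon)
    fix e :: real assume e: "e > 0"
    \<comment> \<open>This choice makes the bound equal to \<open>e\<close>; the summand 1 keeps the
      denominator positive when \<open>a = b\<close>.\<close>
    have "norm (f b - f a) \<le> e / (b - a + 1) * (b - a) + e / (b - a + 1)"
      using e ab by (intro small) auto
    also have "\<dots> = e / (b - a + 1) * (b - a + 1)" by (simp only: distrib_left mult_1_right)
    also have "\<dots> = e" using ab by simp
    finally show "norm (f b - f a) \<le> 0 + e" by simp
  qed
  then show ?thesis by simp
qed

text \<open>The definition is applied to the single interval between \<open>x\<close> and
  \<open>y\<close>, with its ends sorted by \<open>min\<close> and \<open>max\<close>.\<close>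

lemma abs_continuous_on_imp_continuous_on:
  assumes "abs_continuous_on a b f"
  shows "continuous_on {a..b} f"
  unfolding continuous_on_iff
proof (intro ballI allI impI)
  fix x \<epsilon> :: real assume x: "x \<in> {a..b}" and \<epsilon>: "\<epsilon> > 0"
  obtain \<delta> where \<delta>: "\<delta> > 0" "\<And>(k::nat) (l::nat \<Rightarrow> real) r.
      (\<forall>j<k. a \<le> l j \<and> l j \<le> r j \<and> r j \<le> b) \<and>
        disjoint_family_on (\<lambda>j. {l j<..<r j}) {..<k} \<and> (\<Sum>j<k. r j - l j) < \<delta> \<Longrightarrow>
        (\<Sum>j<k. norm (f (r j) - f (l j))) < \<epsilon>"
    using assms \<epsilon> unfolding abs_continuous_on_def by blast
  have "dist (f y) (f x) < \<epsilon>" if "y \<in> {a..b}" "dist y x < \<delta>" for y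
  proof -
    have "norm (f (max x y) - f (min x y)) < \<epsilon>"
      using \<delta>(2)[of 1 "\<lambda>_. min x y" "\<lambda>_. max x y"] that x
      by (auto simp: disjoint_family_on_def dist_real_def max_def min_def)
    then show ?thesis
      by (auto simp: max_def min_def dist_norm norm_minus_commute split: if_splits)
  qed
  then show "\<exists>d>0. \<forall>y\<in>{a..b}. dist y x < d \<longrightarrow> dist (f y) (f x) < \<epsilon>"
    using \<delta>(1) by blast
qed

section \<open>Products, differences and primitives of absolutely continuous type\<close>

lemma continuous_on_Icc_bound:
  fixes f :: "real \<Rightarrow> 'a::real_normed_vector"
  assumes "continuous_on {a..b} f"
  obtains C where "C > 0" "\<And>t. t \<in> {a..b} \<Longrightarrow> norm (f t) \<le> C"
  using compact_imp_bounded[OF compact_continuous_image[OF assms compact_Icc]]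
  unfolding bounded_pos by (metis imageI)

lemma abs_continuous_on_bilinear:
  assumes op: "bounded_bilinear op" and f: "abs_continuous_on a b f" and g: "abs_continuous_on a b g"
  shows "abs_continuous_on a b (\<lambda>t. op (f t) (g t))"
proof -
  interpret bounded_bilinear op by (rule op)
  obtain K where K: "K > 0" "\<And>c y. norm (op c y) \<le> norm c * norm y * K"
    using pos_bounded by blast
  obtain C where C: "C > 0" "\<And>t. t \<in> {a..b} \<Longrightarrow> norm (f t) \<le> C"
    using continuous_on_Icc_bound[OF abs_continuous_on_imp_continuous_on[OF f]] by blast
  obtain D where D: "D > 0" "\<And>t. t \<in> {a..b} \<Longrightarrow> norm (g t) \<le> D"
    using continuous_on_Icc_bound[OF abs_continuous_on_imp_continuous_on[OF g]] by blast
  show ?thesis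
  proof (rule abs_continuous_on_dominated[OF f g, where M = "(C + D) * K" and L = 0])
    fix l r assume lr: "a \<le> l" "l \<le> r" "r \<le> b"
    have "op (f r) (g r) - op (f l) (g l) = op (f r) (g r - g l) + op (f r - f l) (g l)"
      by (simp add: diff_left diff_right)
    also have "norm \<dots> \<le> norm (f r) * norm (g r - g l) * K + norm (f r - f l) * norm (g l) * K"
      by (rule order_trans[OF norm_triangle_ineq add_mono[OF K(2) K(2)]])
    also have "\<dots> \<le> (C + D) * norm (g r - g l) * K + norm (f r - f l) * (C + D) * K"
    proof -
      have "norm (f r) \<le> C + D" "norm (g l) \<le> C + D"
        using C(2)[of r] D(2)[of l] C(1) D(1) lr by auto
      then show ?thesis using K(1) by (intro add_mono mult_right_mono mult_left_mono) auto
    qed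
    finally show "norm (op (f r) (g r) - op (f l) (g l)) \<le>
        (C + D) * K * (norm (f r - f l) + norm (g r - g l)) + 0 * (r - l)"
      by (simp add: algebra_simps)
  qed
qed

lemma abs_continuous_on_diff:
  assumes "abs_continuous_on a b f" and "abs_continuous_on a b g"
  shows "abs_continuous_on a b (\<lambda>t. f t - g t)"
proof (rule abs_continuous_on_dominated[OF assms, where M = 1 and L = 0])
  fix l r
  have "norm (f r - g r - (f l - g l)) = norm ((f r - f l) - (g r - g l))" by (simp add: algebra_simps)
  also have "\<dots> \<le> norm (f r - f l) + norm (g r - g l)" by (rule norm_triangle_ineq4)
  finally show "norm (f r - g r - (f l - g l)) \<le>
      1 * (norm (f r - f l) + norm (g r - g l)) + 0 * (r - l)" by simp
qed

lemma abs_continuous_on_integral: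
  fixes f :: "real \<Rightarrow> 'a::euclidean_space"
  assumes f: "f integrable_on {a..b}" and bd: "bounded (f ` {a..b})"
  shows "abs_continuous_on a b (\<lambda>t. c + integral {a..t} f)"
proof -
  obtain C where C: "C > 0" "\<And>t. t \<in> {a..b} \<Longrightarrow> norm (f t) \<le> C"
    using bd unfolding bounded_pos by blast
  show ?thesis
  proof (rule abs_continuous_on_lipschitz[where L = C])
    fix l r assume lr: "a \<le> l" "l \<le> r" "r \<le> b"
    have int: "f integrable_on {l..r}" "f integrable_on {a..r}"
      using lr by (auto intro: integrable_on_subinterval[OF f])
    have "integral {a..l} f + integral {l..r} f = integral {a..r} f"
      using lr int by (intro Henstock_Kurzweil_Integration.integral_combine) auto
    then have "(c + integral {a..r} f) - (c + integral {a..l} f) = integral {l..r} f"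
      by (simp add: algebra_simps)
    also have "norm \<dots> \<le> integral {l..r} (\<lambda>_. C)"
      using lr C by (intro integral_norm_bound_integral int) auto
    also have "\<dots> = C * (r - l)" using lr by simp
    finally show "norm ((c + integral {a..r} f) - (c + integral {a..l} f)) \<le> C * (r - l)" .
  qed
qed

lemma abs_continuous_on_C1:
  fixes f :: "real \<Rightarrow> 'a::euclidean_space"
  assumes der: "\<And>t. t \<in> {a..b} \<Longrightarrow> (f has_vector_derivative f' t) (at t within {a..b})"
    and f': "continuous_on {a..b} f'"
  shows "abs_continuous_on a b f"
proof -
  obtain C where C: "C > 0" "\<And>t. t \<in> {a..b} \<Longrightarrow> norm (f' t) \<le> C"
    using continuous_on_Icc_bound[OF f'] by blast
  show ?thesis
  proof (rule abs_continuous_on_lipschitz[where L = C])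
    fix l r assume lr: "a \<le> l" "l \<le> r" "r \<le> b"
    then have "(f' has_integral (f r - f l)) {l..r}"
      by (intro fundamental_theorem_of_calculus)
         (auto intro!: has_vector_derivative_within_subset[OF der])
    from has_integral_bound_real[OF _ finite.emptyI this, of C] show "norm (f r - f l) \<le> C * (r - l)"
      using C lr by simp
  qed
qed

text \<open>Extended by zero, \<open>f\<close> is continuous off \<open>F\<close> and the two end
  points, hence Borel measurable; boundedness on a set of finite measure then gives
  integrability.\<close>

lemma integrable_bounded_piecewise_continuous:
  fixes f :: "real \<Rightarrow> 'a::euclidean_space"
  assumes F: "finite F" and bd: "bounded (f ` {a..b})" and f: "continuous_on ({a..b} - F) f"
  shows "f integrable_on {a..b}"
proof -
  obtain C where C: "\<And>t. t \<in> {a..b} \<Longrightarrow> norm (f t) \<le> C"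
    using bd unfolding bounded_iff by blast
  define g where "g t = (if t \<in> {a..b} then f t else 0)" for t
  have "continuous_on (({a<..<b} - F) \<union> (- {a..b} - F)) g"
  proof (rule continuous_on_open_Un)
    show "open ({a<..<b} - F)" "open (- {a..b} - F)"
      using finite_imp_closed[OF F] by (auto intro: open_Diff)
    have "continuous_on ({a<..<b} - F) f" by (rule continuous_on_subset[OF f]) auto
    then show "continuous_on ({a<..<b} - F) g"
      by (rule continuous_on_eq) (auto simp: g_def)
    show "continuous_on (- {a..b} - F) g"
      by (rule continuous_on_eq[OF continuous_on_const[of _ 0]]) (auto simp: g_def)
  qed
  moreover have "- (F \<union> {a, b}) \<subseteq> ({a<..<b} - F) \<union> (- {a..b} - F)" by auto
  ultimately have "continuous_on (- (F \<union> {a, b})) g" by (rule continuous_on_subset)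
  then have "g \<in> borel_measurable borel"
    using F by (intro borel_measurable_continuous_countable_exceptions[of "F \<union> {a, b}"])
      (auto intro: countable_finite)
  then have "g \<in> borel_measurable lebesgue"
    by (intro measurable_completion) simp
  then have "f \<in> borel_measurable (lebesgue_on {a..b})"
    unfolding g_def by (subst (asm) borel_measurable_if) auto
  then show ?thesis
    by (rule measurable_bounded_by_integrable_imp_integrable[where g = "\<lambda>_. C"]) (use C in auto)
qed

section \<open>The flow of the linear system\<close>

text \<open>\<open>\<Phi>\<close> is the fundamental matrix started at \<open>ta p\<close>. Its
  inverse \<open>\<Psi>\<close> is described by its own (adjoint) equation, so products with
  \<open>\<Psi>\<close> can be differentiated without differentiating an inverse.\<close>

locale lq_flow =
  fixes p :: "('n::finite, 'm::finite) lq_problem" and \<Phi> \<Psi> :: "real \<Rightarrow> real^'n^'n"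
  assumes valid: "valid_lq p"
    and Phi_deriv: "\<And>t. t \<in> {ta p..tb p} \<Longrightarrow>
      (\<Phi> has_vector_derivative Amat p t ** \<Phi> t) (at t within {ta p..tb p})"
    and Psi_deriv: "\<And>t. t \<in> {ta p..tb p} \<Longrightarrow>
      (\<Psi> has_vector_derivative - (\<Psi> t ** Amat p t)) (at t within {ta p..tb p})"
    and Psi_Phi: "\<And>t. t \<in> {ta p..tb p} \<Longrightarrow> \<Psi> t ** \<Phi> t = mat 1"
    and Phi_ta: "\<Phi> (ta p) = mat 1"

lemma lq_flow_exists:
  fixes p :: "('n::finite, 'm::finite) lq_problem"
  assumes "valid_lq p"
  shows "\<exists>\<Phi> \<Psi>. lq_flow p \<Phi> \<Psi>"
proof -
  note bb = bounded_bilinear_matrix_mult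
  have A: "continuous_on {ta p..tb p} (Amat p)" and ab: "ta p \<le> tb p"
    using assms by (auto simp: valid_lq_def)
  obtain \<Phi> :: "real \<Rightarrow> real^'n^'n" where \<Phi>: "\<Phi> (ta p) = mat 1" "\<And>t. t \<in> {ta p..tb p} \<Longrightarrow>
      (\<Phi> has_vector_derivative Amat p t ** \<Phi> t) (at t within {ta p..tb p})"
    using linear_ode_exists[OF bb A ab, of "mat 1"] by blast
  \<comment> \<open>Flipping the bilinear operation turns left into right multiplication, so the
    same existence lemma solves the adjoint equation.\<close>
  obtain \<Psi> :: "real \<Rightarrow> real^'n^'n" where \<Psi>: "\<Psi> (ta p) = mat 1" "\<And>t. t \<in> {ta p..tb p} \<Longrightarrow>
      (\<Psi> has_vector_derivative \<Psi> t ** - Amat p t) (at t within {ta p..tb p})"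
    using linear_ode_exists[OF bounded_bilinear.flip[OF bb] continuous_on_minus[OF A] ab, of "mat 1"]
    by blast
  have \<Psi>': "(\<Psi> has_vector_derivative - (\<Psi> t ** Amat p t)) (at t within {ta p..tb p})"
    if "t \<in> {ta p..tb p}" for t
    using \<Psi>(2)[OF that] by (simp add: bounded_bilinear.minus_right[OF bb])
  have "((\<lambda>t. \<Psi> t ** \<Phi> t) has_vector_derivative 0) (at t within {ta p..tb p})"
    if t: "t \<in> {ta p..tb p}" for t
    using bounded_bilinear.has_vector_derivative[OF bb \<Psi>'[OF t] \<Phi>(2)[OF t]]
    by (simp add: bounded_bilinear.minus_left[OF bb] matrix_mul_assoc)
  then obtain C where "\<And>t. t \<in> {ta p..tb p} \<Longrightarrow> \<Psi> t ** \<Phi> t = C"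
    using has_vector_derivative_zero_constant[of "{ta p..tb p}" "\<lambda>t. \<Psi> t ** \<Phi> t"] by auto
  then have "\<Psi> t ** \<Phi> t = mat 1" if "t \<in> {ta p..tb p}" for t
    using that ab \<Phi>(1) \<Psi>(1) by (metis atLeastAtMost_iff matrix_mul_lid order_refl)
  then have "lq_flow p \<Phi> \<Psi>"
    using assms \<Phi> \<Psi>' by unfold_locales auto
  then show ?thesis by blast
qed

context lq_flow
begin

abbreviation "I \<equiv> {ta p..tb p}"

lemma ta_less_tb: "ta p < tb p" using valid by (simp add: valid_lq_def)

lemma ta_in: "ta p \<in> I" using ta_less_tb by simp

lemma data_continuous:
  "continuous_on I (xref p)" "continuous_on I (omega p)" "continuous_on I (vref p)"
  "continuous_on I (Amat p)" "continuous_on I (Bmat p)" "continuous_on I (Wmat p)"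
  "continuous_on I (Rmat p)"
  using valid by (simp_all add: valid_lq_def)

lemma Phi_Psi: "t \<in> I \<Longrightarrow> \<Phi> t ** \<Psi> t = mat 1"
  using Psi_Phi matrix_left_right_inverse by blast

lemma Phi_continuous: "continuous_on I \<Phi>"
  using Phi_deriv by (intro continuous_on_vector_derivative)

lemma Psi_continuous: "continuous_on I \<Psi>"
  using Psi_deriv by (intro continuous_on_vector_derivative)

lemma Phi_abs_continuous: "abs_continuous_on (ta p) (tb p) \<Phi>"
  by (rule abs_continuous_on_C1[OF Phi_deriv], assumption)
     (intro continuous_on_matrix_mult data_continuous Phi_continuous)

lemma Psi_abs_continuous: "abs_continuous_on (ta p) (tb p) \<Psi>"
  by (rule abs_continuous_on_C1[OF Psi_deriv], assumption)
     (intro continuous_on_minus continuous_on_matrix_mult data_continuous Psi_continuous)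

text \<open>For any solution \<open>X\<close> the product \<open>\<Psi> t ** X t\<close> has
  derivative zero, so it keeps its value \<open>\<Psi> s\<close> at time \<open>s\<close>;
  multiplying by \<open>\<Phi> t\<close> recovers \<open>X t\<close>.\<close>

lemma trans_mat_eq:
  assumes s: "s \<in> I" and t: "t \<in> I"
  shows "trans_mat p t s = \<Phi> t ** \<Psi> s"
proof -
  note bb = bounded_bilinear_matrix_mult
  let ?Z = "\<lambda>t. if t \<in> I then \<Phi> t ** \<Psi> s else 0"
  have Z: "is_transition p s ?Z"
    unfolding is_transition_def
  proof (intro conjI ballI allI impI)
    fix t assume t: "t \<in> I"
    have "((\<lambda>t. \<Phi> t ** \<Psi> s) has_vector_derivative Amat p t ** ?Z t) (at t within I)"
      using bounded_bilinear.has_vector_derivative[OF bb Phi_deriv[OF t] has_vector_derivative_const, of "\<Psi> s"] t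
      by (simp add: bounded_bilinear.zero_right[OF bb] matrix_mul_assoc)
    then show "(?Z has_vector_derivative Amat p t ** ?Z t) (at t within I)"
      by (rule has_vector_derivative_transform[OF t, rotated]) simp
  qed (use s Phi_Psi in auto)
  have "X = ?Z" if X: "is_transition p s X" for X
  proof
    fix t
    show "X t = ?Z t"
    proof (cases "t \<in> I")
      case True
      have "((\<lambda>t. \<Psi> t ** X t) has_vector_derivative 0) (at t within I)" if t: "t \<in> I" for t
      proof -
        have "(X has_vector_derivative Amat p t ** X t) (at t within I)"
          using X t by (simp add: is_transition_def)
        from bounded_bilinear.has_vector_derivative[OF bb Psi_deriv[OF t] this] show ?thesis
          by (simp add: bounded_bilinear.minus_left[OF bb] matrix_mul_assoc)
      qed
      then obtain C where C: "\<And>t. t \<in> I \<Longrightarrow> \<Psi> t ** X t = C"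
        using has_vector_derivative_zero_constant[of I "\<lambda>t. \<Psi> t ** X t"] by auto
      have "\<Psi> t ** X t = \<Psi> s"
        using C[OF True] C[OF s] X by (simp add: is_transition_def)
      then have "\<Phi> t ** \<Psi> s = X t"
        using Phi_Psi[OF True] by (metis matrix_mul_assoc matrix_mul_lid)
      then show ?thesis using True by simp
    next
      case False then show ?thesis using X by (auto simp: is_transition_def)
    qed
  qed
  with Z have "(THE X. is_transition p s X) = ?Z" by (intro the_equality)
  then show ?thesis using t by (simp add: trans_mat_def)
qed

lemma is_state_unique:
  assumes 1: "is_state p u q1" and 2: "is_state p u q2"
  shows "q1 = q2"
proof
  note bb = bounded_bilinear_matrix_vector_mult
  fix t
  show "q1 t = q2 t"
  proof (cases "t \<in> I")
    case True
    define f where "f s = \<Psi> s *v (q1 s - q2 s)" for s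
    have ac: "abs_continuous_on (ta p) (tb p) f"
      unfolding f_def using 1 2
      by (intro abs_continuous_on_bilinear[OF bb Psi_abs_continuous] abs_continuous_on_diff)
        (auto simp: is_state_def)
    let ?D = "\<lambda>q t. (q has_vector_derivative (Amat p t *v q t + Bmat p t *v u t + omega p t))
          (at t within I)"
    \<comment> \<open>Each state obeys its equation off its own null set; one common exceptional set
      allows the two equations to be subtracted pointwise.\<close>
    have "AE t in lebesgue. t \<in> I \<longrightarrow> ?D q1 t \<and> ?D q2 t"
      using 1 2 by (auto simp: is_state_def)
    then obtain E where E: "E \<in> null_sets lebesgue"
        "\<And>t. t \<in> space lebesgue - E \<Longrightarrow> t \<in> I \<longrightarrow> ?D q1 t \<and> ?D q2 t"
      by (rule AE_E3) blast
    have "f t = f (ta p)"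
    proof (rule abs_continuous_on_deriv_zero)
      show "abs_continuous_on (ta p) t f"
        using True by (intro abs_continuous_on_subset[OF ac]) auto
      show "ta p \<le> t" using True by simp
      show "negligible E" using E(1) by (simp add: negligible_iff_null_sets)
      fix s assume s: "s \<in> {ta p..t} - E"
      then have sI: "s \<in> I" using True by auto
      have "?D q1 s" "?D q2 s" using E(2)[of s] s sI by auto
      from has_vector_derivative_diff[OF this]
      have d: "((\<lambda>t. q1 t - q2 t) has_vector_derivative Amat p s *v (q1 s - q2 s)) (at s within I)"
        by (simp add: matrix_vector_mult_diff_distrib)
      have "(f has_vector_derivative 0) (at s within I)"
        using bounded_bilinear.has_vector_derivative[OF bb Psi_deriv[OF sI] d]
        unfolding f_def by (simp add: bounded_bilinear.minus_left[OF bb] matrix_vector_mul_assoc)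
      then show "(f has_vector_derivative 0) (at s within {ta p..t})"
        using True by (elim has_vector_derivative_within_subset) auto
    qed
    also have "\<dots> = 0" using 1 2 by (simp add: f_def is_state_def)
    finally have "\<Phi> t *v f t = 0" by simp
    then show ?thesis
      unfolding f_def by (simp add: matrix_vector_mul_assoc Phi_Psi[OF True])
  next
    case False then show ?thesis using 1 2 by (simp add: is_state_def)
  qed
qed

text \<open>The inhomogeneity transported back to the initial time by \<open>\<Psi>\<close>; its
  primitive added to \<open>qa p\<close> and mapped by \<open>\<Phi> t\<close> is the state.\<close>

definition forcing :: "(real \<Rightarrow> real^'m) \<Rightarrow> real \<Rightarrow> real^'n" where
  "forcing u s = \<Psi> s *v (Bmat p s *v u s + omega p s)"

lemma forcing_piecewise_continuous:
  assumes "bounded (u ` I)" and u: "continuous_on (I - F) u"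
  shows "bounded (forcing u ` I)" "continuous_on (I - F) (forcing u)"
proof -
  note bb = bounded_bilinear_matrix_vector_mult
  obtain C where C: "C > 0" "\<And>t. t \<in> I \<Longrightarrow> norm (u t) \<le> C"
    using assms(1) unfolding bounded_pos by blast
  have c1: "continuous_on I (\<lambda>s. \<Psi> s *v omega p s)"
    by (intro continuous_on_matrix_vector_mult Psi_continuous data_continuous)
  have c2: "continuous_on I (\<lambda>s. \<Psi> s ** Bmat p s)"
    by (intro continuous_on_matrix_mult Psi_continuous data_continuous)
  \<comment> \<open>Regrouped so that the factors around \<open>u\<close> are continuous and all
    discontinuities come from \<open>u\<close>.\<close>
  have eq: "forcing u = (\<lambda>s. (\<Psi> s ** Bmat p s) *v u s + \<Psi> s *v omega p s)"
    by (simp add: forcing_def fun_eq_iff matrix_vector_right_distrib matrix_vector_mul_assoc)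
  have sub: "I - F \<subseteq> I" by auto
  show "continuous_on (I - F) (forcing u)"
    unfolding eq
    by (intro continuous_on_add continuous_on_matrix_vector_mult u
        continuous_on_subset[OF c1 sub] continuous_on_subset[OF c2 sub])
  obtain C1 where C1: "\<And>t. t \<in> I \<Longrightarrow> norm (\<Psi> t *v omega p t) \<le> C1"
    using continuous_on_Icc_bound[OF c1] by blast
  obtain C2 where C2: "C2 > 0" "\<And>t. t \<in> I \<Longrightarrow> norm (\<Psi> t ** Bmat p t) \<le> C2"
    using continuous_on_Icc_bound[OF c2] by blast
  obtain K where K: "K > 0" "\<And>(M::real^'m^'n) x. norm (M *v x) \<le> norm M * norm x * K"
    using bounded_bilinear.pos_bounded[OF bb] by blast
  have "norm (forcing u t) \<le> C2 * C * K + C1" if t: "t \<in> I" for t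
  proof -
    have "norm ((\<Psi> t ** Bmat p t) *v u t) \<le> norm (\<Psi> t ** Bmat p t) * norm (u t) * K" by (rule K(2))
    also have "\<dots> \<le> C2 * C * K"
      using C C2 K t by (intro mult_right_mono mult_mono) (auto intro: less_imp_le)
    finally show ?thesis
      unfolding eq using C1[OF t] by (intro norm_triangle_mono)
  qed
  then show "bounded (forcing u ` I)" unfolding bounded_iff by blast
qed

lemma forcing_integrable:
  assumes "finite F" "bounded (u ` I)" "continuous_on (I - F) u"
  shows "forcing u integrable_on I"
  by (rule integrable_bounded_piecewise_continuous[OF assms(1) forcing_piecewise_continuous])
     (use assms in auto)

text \<open>The formula is checked to define a state: its derivative is right off the finite set
  \<open>F\<close>, which is null. Uniqueness then identifies it with the object chosen by
  \<open>state\<close>.\<close>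

lemma state_variation_of_constants:
  assumes F: "finite F" and bd: "bounded (u ` I)" and u: "continuous_on (I - F) u" and t: "t \<in> I"
  shows "state p u t = \<Phi> t *v (qa p + integral {ta p..t} (forcing u))"
proof -
  note bb = bounded_bilinear_matrix_vector_mult
  note f = forcing_piecewise_continuous[OF bd u] and fi = forcing_integrable[OF F bd u]
  define G where "G t = qa p + integral {ta p..t} (forcing u)" for t
  let ?q = "\<lambda>t. if t \<in> I then \<Phi> t *v G t else 0"
  have "is_state p u ?q"
    unfolding is_state_def
  proof (intro conjI allI impI)
    have "abs_continuous_on (ta p) (tb p) (\<lambda>t. \<Phi> t *v G t)"
      unfolding G_def
      by (intro abs_continuous_on_bilinear[OF bb Phi_abs_continuous]
          abs_continuous_on_integral[OF fi f(1)])
    \<comment> \<open>Extension by zero leaves increments inside the interval unchanged; the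
      constant function is a dummy second dominating term.\<close>
    then show "abs_continuous_on (ta p) (tb p) ?q"
      by (rule abs_continuous_on_dominated[OF _ abs_continuous_on_const[of _ _ "0::real"],
            where M = 1 and L = 0]) auto
    have der: "(?q has_vector_derivative (Amat p t *v ?q t + Bmat p t *v u t + omega p t)) (at t within I)"
      if t: "t \<in> I - F" for t
    proof -
      have "((\<lambda>t. integral {ta p..t} (forcing u)) has_vector_derivative forcing u t) (at t within I - F)"
        using f(2) t by (intro integral_has_vector_derivative_continuous_at[OF fi t F])
          (auto simp: continuous_on_eq_continuous_within)
      \<comment> \<open>The finite set \<open>F\<close> is closed, so its complement is a
        neighbourhood of \<open>t\<close> and removing \<open>F\<close> does not affect the
        limit.\<close>
      moreover have "at t within I - F = at t within I"
        using t finite_imp_closed[OF F] by (intro at_within_nhd[of t "- F"]) auto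
      ultimately have "(G has_vector_derivative forcing u t) (at t within I)"
        unfolding G_def using has_vector_derivative_add[OF has_vector_derivative_const] by fastforce
      from bounded_bilinear.has_vector_derivative[OF bb Phi_deriv this] t
      have "((\<lambda>t. \<Phi> t *v G t) has_vector_derivative
          \<Phi> t *v forcing u t + (Amat p t ** \<Phi> t) *v G t) (at t within I)" by simp
      moreover have "\<Phi> t *v forcing u t = Bmat p t *v u t + omega p t"
        using t Phi_Psi[of t] by (simp add: forcing_def matrix_vector_mul_assoc)
      ultimately have "((\<lambda>t. \<Phi> t *v G t) has_vector_derivative
          (Amat p t *v ?q t + Bmat p t *v u t + omega p t)) (at t within I)"
        using t by (simp add: matrix_vector_mul_assoc algebra_simps)
      then show ?thesis
        by (rule has_vector_derivative_transform[rotated -1]) (use t in auto)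
    qed
    have "F \<in> null_sets lebesgue"
      using negligible_finite[OF F] by (simp add: negligible_iff_null_sets)
    then show "AE t in lebesgue. t \<in> I \<longrightarrow>
        (?q has_vector_derivative (Amat p t *v ?q t + Bmat p t *v u t + omega p t)) (at t within I)"
      by (rule AE_I') (use der in auto)
    show "?q (ta p) = qa p" using ta_in Phi_ta by (simp add: G_def)
  qed auto
  then have "state p u = ?q"
    unfolding state_def using is_state_unique by blast
  then show ?thesis using t by (simp add: G_def)
qed

end

section \<open>One sampling step\<close>

lemma inner_transpose_mult:
  fixes W :: "real^'n^'n" and A :: "real^'k^'n" and B :: "real^'l^'n"
  shows "((transpose A ** W ** B) *v x) \<bullet> z = (W *v (B *v x)) \<bullet> (A *v z)"
  by (simp only: matrix_vector_mul_assoc[symmetric] inner_matrix_transpose)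

lemma inner_transpose_mult_vector:
  fixes W :: "real^'n^'n" and A :: "real^'k^'n"
  shows "((transpose A ** W) *v g) \<bullet> z = (W *v g) \<bullet> (A *v z)"
  by (simp only: matrix_vector_mul_assoc[symmetric] inner_matrix_transpose)

lemma symmetric_inner_commute:
  fixes W :: "real^'n^'n"
  assumes "transpose W = W"
  shows "(W *v x) \<bullet> y = (W *v y) \<bullet> x"
  using inner_matrix_transpose[of W x y] assms by (simp add: inner_commute)

text \<open>It serves both cost contributions: with \<open>Wmat p \<tau>\<close> the six terms
  integrate to the W-coefficients of a step, and with \<open>K\<close> they are the K-parts of Q, P,
  T, G, H and F.\<close>

lemma quadratic_form_expand:
  fixes W :: "real^'n^'n" and Z :: "real^'k^'n" and B :: "real^'l^'n"
  assumes "transpose W = W"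
  shows "(W *v (Z *v y + B *v c + g)) \<bullet> (Z *v y + B *v c + g) =
    ((transpose Z ** W ** Z) *v y) \<bullet> y + 2 * (((transpose B ** W ** Z) *v y) \<bullet> c) +
    ((transpose B ** W ** B) *v c) \<bullet> c + 2 * (((transpose Z ** W) *v g) \<bullet> y) +
    2 * (((transpose B ** W) *v g) \<bullet> c) + (W *v g) \<bullet> g"
  unfolding inner_transpose_mult inner_transpose_mult_vector
  using symmetric_inner_commute[OF assms, of "Z *v y" "B *v c"]
    symmetric_inner_commute[OF assms, of "Z *v y" g] symmetric_inner_commute[OF assms, of "B *v c" g]
  by (simp add: matrix_vector_right_distrib inner_add_left inner_add_right)

lemma has_integral_matrix_inner:
  fixes M :: "real \<Rightarrow> real^'n^'m"
  assumes M: "continuous_on {a..b} M"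
  shows "((\<lambda>\<tau>. (M \<tau> *v y) \<bullet> z) has_integral (integral {a..b} M *v y) \<bullet> z) {a..b}"
proof -
  have "bounded_linear (\<lambda>M::real^'n^'m. (M *v y) \<bullet> z)"
    by (intro bounded_linear_inner_left_comp
        bounded_bilinear.bounded_linear_left[OF bounded_bilinear_matrix_vector_mult])
  from has_integral_linear[OF integrable_integral[OF integrable_continuous_real[OF M]] this]
  show ?thesis by (simp add: o_def)
qed

lemma integral_matrix_vector:
  fixes M :: "real \<Rightarrow> real^'n^'m"
  assumes "M integrable_on D"
  shows "integral D (\<lambda>\<tau>. M \<tau> *v y) = integral D M *v y"
  using integral_linear[OF assms
      bounded_bilinear.bounded_linear_left[OF bounded_bilinear_matrix_vector_mult, of y]]
  by (simp add: o_def)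

lemma has_integral_vector_inner:
  fixes f :: "real \<Rightarrow> real^'n"
  assumes f: "continuous_on {a..b} f"
  shows "((\<lambda>\<tau>. f \<tau> \<bullet> z) has_integral integral {a..b} f \<bullet> z) {a..b}"
  using has_integral_linear[OF integrable_integral[OF integrable_continuous_real[OF f]]
      bounded_linear_inner_left, of z] by (simp add: o_def)

locale lq_grid = lq_flow p \<Phi> \<Psi>
  for p :: "('n::finite, 'm::finite) lq_problem" and \<Phi> \<Psi> :: "real \<Rightarrow> real^'n^'n" +
  fixes N :: nat and h :: "nat \<Rightarrow> real"
  assumes steps: "valid_steps p N h"
begin

section \<open>Nodes, cells and continuity of the coefficients\<close>

abbreviation "\<sigma> \<equiv> node p h"
abbreviation "D i \<equiv> {\<sigma> i..\<sigma> (Suc i)}"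

lemma N_pos: "1 \<le> N" using steps by (simp add: valid_steps_def)

lemma node_less: "i < N \<Longrightarrow> \<sigma> i < \<sigma> (Suc i)"
  using steps by (simp add: valid_steps_def node_def)

lemma node_0: "\<sigma> 0 = ta p" by (simp add: node_def)

lemma node_N: "\<sigma> N = tb p" using steps by (simp add: valid_steps_def node_def)

lemma node_mono: "i \<le> j \<Longrightarrow> j \<le> N \<Longrightarrow> \<sigma> i \<le> \<sigma> j"
proof (induction j rule: dec_induct)
  case (step k) then show ?case using node_less[of k] by auto
qed simp

lemma node_in: "i \<le> N \<Longrightarrow> \<sigma> i \<in> I"
  using node_mono[of 0 i] node_mono[of i N] by (simp add: node_0 node_N)

lemma D_subset: "i < N \<Longrightarrow> D i \<subseteq> I"
  using node_in[of i] node_in[of "Suc i"] by auto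

lemma node_cover:
  assumes "t \<in> {ta p..<tb p}"
  shows "\<exists>i<N. t \<in> {\<sigma> i..<\<sigma> (Suc i)}"
proof -
  have "j \<le> N \<Longrightarrow> t \<in> {\<sigma> 0..<\<sigma> j} \<Longrightarrow> \<exists>i<N. t \<in> {\<sigma> i..<\<sigma> (Suc i)}" for j
  proof (induction j)
    case (Suc j)
    show ?case
    proof (cases "t < \<sigma> j")
      case True then show ?thesis using Suc by auto
    next
      case False then show ?thesis using Suc.prems by (intro exI[of _ j]) auto
    qed
  qed simp
  from this[of N] show ?thesis using assms by (simp add: node_0 node_N)
qed

text \<open>What remains of \<open>beta\<close> once \<open>\<Phi> \<tau>\<close> is pulled out: a
  plain primitive, although the integrand of \<open>beta\<close> itself varies with
  \<open>\<tau>\<close>.\<close>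

definition IB :: "nat \<Rightarrow> real \<Rightarrow> real^'m^'n" where
  "IB i \<tau> = integral {\<sigma> i..\<tau>} (\<lambda>s. \<Psi> s ** Bmat p s)"

definition IO :: "nat \<Rightarrow> real \<Rightarrow> real^'n" where
  "IO i \<tau> = integral {\<sigma> i..\<tau>} (\<lambda>s. \<Psi> s *v omega p s)"

lemma Psi_B_continuous: "continuous_on I (\<lambda>s. \<Psi> s ** Bmat p s)"
  by (intro continuous_on_matrix_mult Psi_continuous data_continuous)

lemma Psi_omega_continuous: "continuous_on I (\<lambda>s. \<Psi> s *v omega p s)"
  by (intro continuous_on_matrix_vector_mult Psi_continuous data_continuous)

lemma continuous_integrable_sub:
  fixes f :: "real \<Rightarrow> 'a::euclidean_space"
  assumes f: "continuous_on I f" and i: "i < N" and \<tau>: "\<tau> \<in> D i"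
  shows "f integrable_on {\<sigma> i..\<tau>}"
proof -
  have "{\<sigma> i..\<tau>} \<subseteq> I" using D_subset[OF i] \<tau> by auto
  then show ?thesis by (intro integrable_continuous_real continuous_on_subset[OF f])
qed

lemma trans_mat_D:
  assumes i: "i < N" and \<tau>: "\<tau> \<in> D i" and s: "s \<in> {\<sigma> i..\<tau>}"
  shows "trans_mat p \<tau> s = \<Phi> \<tau> ** \<Psi> s"
proof -
  have "s \<in> D i" using \<tau> s by auto
  then show ?thesis using \<tau> D_subset[OF i] by (intro trans_mat_eq) auto
qed

lemma integral_trans_mat_B:
  assumes i: "i < N" and \<tau>: "\<tau> \<in> D i"
  shows "integral {\<sigma> i..\<tau>} (\<lambda>s. trans_mat p \<tau> s ** Bmat p s) = \<Phi> \<tau> ** IB i \<tau>"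
proof -
  have "integral {\<sigma> i..\<tau>} (\<lambda>s. trans_mat p \<tau> s ** Bmat p s) =
      integral {\<sigma> i..\<tau>} (\<lambda>s. \<Phi> \<tau> ** (\<Psi> s ** Bmat p s))"
    by (intro integral_cong) (simp add: trans_mat_D[OF i \<tau>] matrix_mul_assoc)
  also have "\<dots> = \<Phi> \<tau> ** IB i \<tau>"
    using integral_linear[OF continuous_integrable_sub[OF Psi_B_continuous i \<tau>]
        bounded_bilinear.bounded_linear_right[OF bounded_bilinear_matrix_mult, of "\<Phi> \<tau>"]]
    by (simp add: o_def IB_def)
  finally show ?thesis .
qed

lemma integral_trans_mat_omega:
  assumes i: "i < N" and \<tau>: "\<tau> \<in> D i"
  shows "integral {\<sigma> i..\<tau>} (\<lambda>s. trans_mat p \<tau> s *v omega p s) = \<Phi> \<tau> *v IO i \<tau>"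
proof -
  have "integral {\<sigma> i..\<tau>} (\<lambda>s. trans_mat p \<tau> s *v omega p s) =
      integral {\<sigma> i..\<tau>} (\<lambda>s. \<Phi> \<tau> *v (\<Psi> s *v omega p s))"
    by (intro integral_cong) (simp add: trans_mat_D[OF i \<tau>] matrix_vector_mul_assoc)
  also have "\<dots> = \<Phi> \<tau> *v IO i \<tau>"
    using integral_linear[OF continuous_integrable_sub[OF Psi_omega_continuous i \<tau>]
        bounded_bilinear.bounded_linear_right[OF bounded_bilinear_matrix_vector_mult, of "\<Phi> \<tau>"]]
    by (simp add: o_def IO_def)
  finally show ?thesis .
qed

lemma beta_eq: "i < N \<Longrightarrow> \<tau> \<in> D i \<Longrightarrow> beta p h i \<tau> = \<Phi> \<tau> ** IB i \<tau>"
  by (simp add: beta_def integral_trans_mat_B)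

lemma gamma_eq: "i < N \<Longrightarrow> \<tau> \<in> D i \<Longrightarrow> gamma p h i \<tau> = \<Phi> \<tau> *v IO i \<tau> - xref p \<tau>"
  by (simp add: gamma_def integral_trans_mat_omega)

lemma continuous_D:
  assumes i: "i < N"
  shows "continuous_on (D i) (\<lambda>\<tau>. trans_mat p \<tau> (\<sigma> i))"
    and "continuous_on (D i) (beta p h i)" and "continuous_on (D i) (gamma p h i)"
    and "continuous_on (D i) (Wmat p)" and "continuous_on (D i) (Rmat p)"
    and "continuous_on (D i) (vref p)"
proof -
  note sub = D_subset[OF i]
  have P: "continuous_on (D i) \<Phi>" by (rule continuous_on_subset[OF Phi_continuous sub])
  have "continuous_on (D i) (\<lambda>\<tau>. \<Phi> \<tau> ** \<Psi> (\<sigma> i))"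
    by (intro continuous_on_matrix_mult P continuous_on_const)
  then show "continuous_on (D i) (\<lambda>\<tau>. trans_mat p \<tau> (\<sigma> i))"
    by (rule continuous_on_eq) (auto simp: trans_mat_D[OF i])
  have "\<sigma> (Suc i) \<in> D i" using node_less[OF i] by simp
  note int = continuous_integrable_sub[OF _ i this]
  have "continuous_on (D i) (\<lambda>\<tau>. \<Phi> \<tau> ** IB i \<tau>)"
    unfolding IB_def
    by (intro continuous_on_matrix_mult P indefinite_integral_continuous_1 int Psi_B_continuous)
  then show "continuous_on (D i) (beta p h i)"
    by (rule continuous_on_eq) (simp add: beta_eq[OF i])
  have "continuous_on (D i) (\<lambda>\<tau>. \<Phi> \<tau> *v IO i \<tau> - xref p \<tau>)"
    unfolding IO_def
    by (intro continuous_on_diff continuous_on_matrix_vector_mult P indefinite_integral_continuous_1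
        int Psi_omega_continuous continuous_on_subset[OF data_continuous(1) sub])
  then show "continuous_on (D i) (gamma p h i)"
    by (rule continuous_on_eq) (simp add: gamma_eq[OF i])
  show "continuous_on (D i) (Wmat p)" "continuous_on (D i) (Rmat p)" "continuous_on (D i) (vref p)"
    by (rule continuous_on_subset[OF _ sub], rule data_continuous)+
qed

section \<open>Sampled controls and their states on one cell\<close>

lemma sampled_value:
  assumes "u \<in> sampled_controls p N h" and "i < N" and "t \<in> {\<sigma> i..<\<sigma> (Suc i)}"
  shows "u t = u (\<sigma> i)"
proof -
  obtain c where "\<forall>t\<in>{\<sigma> i..<\<sigma> (Suc i)}. u t = c"
    using assms(1,2) unfolding sampled_controls_def by blast
  then show ?thesis using assms(3) node_less[OF assms(2)] by (metis atLeastLessThan_iff order_refl)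
qed

lemma sampled_piecewise_continuous:
  assumes u: "u \<in> sampled_controls p N h"
  shows "bounded (u ` I)" and "continuous_on (I - \<sigma> ` {..N}) u"
proof -
  have "u ` I \<subseteq> insert 0 ((\<lambda>i. u (\<sigma> i)) ` {..<N})"
  proof
    fix y assume "y \<in> u ` I"
    then obtain t where t: "t \<in> I" "y = u t" by blast
    show "y \<in> insert 0 ((\<lambda>i. u (\<sigma> i)) ` {..<N})"
    proof (cases "t \<in> {ta p..<tb p}")
      case True
      then obtain i where "i < N" "t \<in> {\<sigma> i..<\<sigma> (Suc i)}" using node_cover by blast
      then show ?thesis using sampled_value[OF u] t(2) by blast
    next
      \<comment> \<open>Inside the interval this is only \<open>t = tb p\<close>, which no half-open
        cell contains and where the control is normalised to zero.\<close>
      case False then show ?thesis using u t by (simp add: sampled_controls_def)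
    qed
  qed
  then show "bounded (u ` I)"
    by (rule bounded_subset[rotated]) (intro finite_imp_bounded, simp)
  have "continuous_on (\<Union>i\<in>{..<N}. {\<sigma> i<..<\<sigma> (Suc i)}) u"
  proof (rule continuous_on_open_UN)
    fix i assume i: "i \<in> {..<N}"
    show "open {\<sigma> i<..<\<sigma> (Suc i)}" by simp
    show "continuous_on {\<sigma> i<..<\<sigma> (Suc i)} u"
      by (rule continuous_on_eq[OF continuous_on_const[of _ "u (\<sigma> i)"]])
        (rule sampled_value[OF u, symmetric], use i in auto)
  qed
  moreover have "I - \<sigma> ` {..N} \<subseteq> (\<Union>i\<in>{..<N}. {\<sigma> i<..<\<sigma> (Suc i)})"
  proof
    fix t assume t: "t \<in> I - \<sigma> ` {..N}"
    then have "t \<noteq> tb p" using node_N by (metis DiffD2 atMost_iff imageI order_refl)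
    then have "t \<in> {ta p..<tb p}" using t by auto
    then obtain i where i: "i < N" "t \<in> {\<sigma> i..<\<sigma> (Suc i)}" using node_cover by blast
    moreover have "t \<noteq> \<sigma> i" using t i(1) by auto
    ultimately show "t \<in> (\<Union>i\<in>{..<N}. {\<sigma> i<..<\<sigma> (Suc i)})"
      by (intro UN_I[of i]) auto
  qed
  ultimately show "continuous_on (I - \<sigma> ` {..N}) u" by (rule continuous_on_subset)
qed

lemma state_sampled:
  assumes u: "u \<in> sampled_controls p N h" and t: "t \<in> I"
  shows "state p u t = \<Phi> t *v (qa p + integral {ta p..t} (forcing u))"
  by (rule state_variation_of_constants[OF _ sampled_piecewise_continuous[OF u] t]) simp

lemma forcing_sampled_integrable:
  assumes u: "u \<in> sampled_controls p N h"
  shows "forcing u integrable_on I"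
  by (rule forcing_integrable[OF _ sampled_piecewise_continuous[OF u]]) simp

text \<open>Applying \<open>\<Psi> (\<sigma> i)\<close> to the state at the node returns the initial
  value plus the forcing accumulated so far, so variation of constants can be restarted there. The
  reference is subtracted because \<open>gamma\<close> contains it.\<close>

lemma state_step:
  assumes u: "u \<in> sampled_controls p N h" and i: "i < N" and \<tau>: "\<tau> \<in> D i"
  shows "state p u \<tau> - xref p \<tau> =
    trans_mat p \<tau> (\<sigma> i) *v state p u (\<sigma> i) + beta p h i \<tau> *v u (\<sigma> i) + gamma p h i \<tau>"
proof -
  have \<tau>I: "\<tau> \<in> I" using D_subset[OF i] \<tau> by auto
  have sI: "\<sigma> i \<in> I" using node_in[of i] i by simp
  have "integral {ta p..\<sigma> i} (forcing u) + integral {\<sigma> i..\<tau>} (forcing u) =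
      integral {ta p..\<tau>} (forcing u)"
    using \<tau> \<tau>I sI
    by (intro Henstock_Kurzweil_Integration.integral_combine
        integrable_on_subinterval[OF forcing_sampled_integrable[OF u]]) auto
  moreover have "integral {\<sigma> i..\<tau>} (forcing u) = IB i \<tau> *v u (\<sigma> i) + IO i \<tau>"
  proof -
    have "integral {\<sigma> i..\<tau>} (forcing u) =
        integral {\<sigma> i..\<tau>} (\<lambda>s. (\<Psi> s ** Bmat p s) *v u (\<sigma> i) + \<Psi> s *v omega p s)"
    \<comment> \<open>At \<open>\<tau> = \<sigma> (Suc i)\<close> the control may already have left
      the value \<open>u (\<sigma> i)\<close>, so the right end is discarded as a null set.\<close>
    proof (rule integral_spike[of "{\<tau>}"])
      fix s assume "s \<in> {\<sigma> i..\<tau>} - {\<tau>}"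
      then have "u s = u (\<sigma> i)" using \<tau> by (intro sampled_value[OF u i]) auto
      then show "(\<Psi> s ** Bmat p s) *v u (\<sigma> i) + \<Psi> s *v omega p s = forcing u s"
        by (simp add: forcing_def matrix_vector_right_distrib matrix_vector_mul_assoc)
    qed simp
    also have "\<dots> = integral {\<sigma> i..\<tau>} (\<lambda>s. (\<Psi> s ** Bmat p s) *v u (\<sigma> i)) + IO i \<tau>"
      unfolding IO_def
      by (intro Henstock_Kurzweil_Integration.integral_add continuous_integrable_sub[OF _ i \<tau>]
          Psi_omega_continuous continuous_on_matrix_vector_mult[OF Psi_B_continuous] continuous_on_const)
    also have "integral {\<sigma> i..\<tau>} (\<lambda>s. (\<Psi> s ** Bmat p s) *v u (\<sigma> i)) = IB i \<tau> *v u (\<sigma> i)"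
      unfolding IB_def
      by (intro integral_matrix_vector continuous_integrable_sub[OF Psi_B_continuous i \<tau>])
    finally show ?thesis .
  qed
  ultimately have "state p u \<tau> =
      \<Phi> \<tau> *v (qa p + integral {ta p..\<sigma> i} (forcing u)) + \<Phi> \<tau> *v (IB i \<tau> *v u (\<sigma> i) + IO i \<tau>)"
    unfolding state_sampled[OF u \<tau>I] by (metis add.assoc matrix_vector_right_distrib)
  moreover have "\<Psi> (\<sigma> i) *v state p u (\<sigma> i) = qa p + integral {ta p..\<sigma> i} (forcing u)"
    unfolding state_sampled[OF u sI] by (simp add: matrix_vector_mul_assoc Psi_Phi[OF sI])
  ultimately show ?thesis
    using \<tau> by (simp add: trans_mat_D[OF i \<tau>] beta_eq[OF i \<tau>] gamma_eq[OF i \<tau>]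
        matrix_vector_mul_assoc[symmetric] matrix_vector_right_distrib)
qed

text \<open>The step formula at the right end of the cell, where the references cancel. Subtracting
  \<open>qb p\<close> at the last node matches the shift inside \<open>ZOm\<close>.\<close>

lemma state_node:
  assumes u: "u \<in> sampled_controls p N h" and i: "i < N"
  shows "state p u (\<sigma> (Suc i)) - (if Suc i = N then qb p else 0) =
    stepZ p h i *v state p u (\<sigma> i) + ZB p h i *v u (\<sigma> i) + ZOm p N h i"
proof -
  have \<tau>: "\<sigma> (Suc i) \<in> D i" using node_less[OF i] by simp
  show ?thesis
    using state_step[OF u i \<tau>]
    by (simp add: stepZ_def ZB_def ZOm_def beta_def gamma_def algebra_simps)
qed

text \<open>The running cost over one step, as a function of the state \<open>y\<close> at its left end and of the
  control value \<open>c\<close>.\<close>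

definition step_cost :: "nat \<Rightarrow> real^'n \<Rightarrow> real^'m \<Rightarrow> real" where
  "step_cost i y c =
    (ZWZ p h i *v y) \<bullet> y + 2 * ((ZBWZ p h i *v y) \<bullet> c) + (ZBWZB p h i *v c) \<bullet> c +
    2 * (ZWZOmX p h i \<bullet> y) + 2 * (ZBWZOmX p h i \<bullet> c) + WZOmX2 p h i +
    (Rint p h i *v c) \<bullet> c - 2 * (RV p h i \<bullet> c) + RV2 p h i"

lemma W_symmetric: "t \<in> I \<Longrightarrow> transpose (Wmat p t) = Wmat p t"
  and R_symmetric: "t \<in> I \<Longrightarrow> transpose (Rmat p t) = Rmat p t"
  using valid by (auto simp: valid_lq_def pos_semidef_def pos_def_def)

text \<open>These three integrals give both the quadratic part of the step cost and, through
  \<open>Wmat\<close>, its sign.\<close>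

lemma quadratic_coefficients_has_integral:
  assumes i: "i < N"
  defines "Z \<equiv> \<lambda>\<tau>. trans_mat p \<tau> (\<sigma> i)" and "b \<equiv> beta p h i"
  shows "((\<lambda>\<tau>. ((transpose (Z \<tau>) ** Wmat p \<tau> ** Z \<tau>) *v y) \<bullet> y)
      has_integral (ZWZ p h i *v y) \<bullet> y) (D i)"
    and "((\<lambda>\<tau>. ((transpose (b \<tau>) ** Wmat p \<tau> ** Z \<tau>) *v y) \<bullet> c)
      has_integral (ZBWZ p h i *v y) \<bullet> c) (D i)"
    and "((\<lambda>\<tau>. ((transpose (b \<tau>) ** Wmat p \<tau> ** b \<tau>) *v c) \<bullet> c)
      has_integral (ZBWZB p h i *v c) \<bullet> c) (D i)"
  unfolding ZWZ_def ZBWZ_def ZBWZB_def Z_def b_def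
  by (rule has_integral_matrix_inner,
      intro continuous_on_matrix_mult continuous_on_transpose continuous_D[OF i])+

text \<open>For fixed \<open>y\<close> and \<open>c\<close> the integrand is a quadratic polynomial
  in them whose coefficients are continuous in \<open>\<tau>\<close>; termwise integration produces
  the named coefficients.\<close>

lemma step_cost_integral:
  assumes i: "i < N"
  defines "w \<equiv> \<lambda>y c \<tau>. trans_mat p \<tau> (\<sigma> i) *v y + beta p h i \<tau> *v c + gamma p h i \<tau>"
  shows "((\<lambda>\<tau>. (Wmat p \<tau> *v w y c \<tau>) \<bullet> w y c \<tau> + (Rmat p \<tau> *v (c - vref p \<tau>)) \<bullet> (c - vref p \<tau>))
    has_integral step_cost i y c) (D i)"
proof -
  let ?Z = "\<lambda>\<tau>. trans_mat p \<tau> (\<sigma> i)" and ?b = "beta p h i" and ?g = "gamma p h i"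
    and ?W = "Wmat p" and ?R = "Rmat p" and ?v = "vref p"
  let ?f1 = "\<lambda>\<tau>. transpose (?Z \<tau>) ** ?W \<tau> ** ?Z \<tau>"
    and ?f2 = "\<lambda>\<tau>. transpose (?b \<tau>) ** ?W \<tau> ** ?Z \<tau>"
    and ?f3 = "\<lambda>\<tau>. transpose (?b \<tau>) ** ?W \<tau> ** ?b \<tau>"
    and ?f4 = "\<lambda>\<tau>. (transpose (?Z \<tau>) ** ?W \<tau>) *v ?g \<tau>"
    and ?f5 = "\<lambda>\<tau>. (transpose (?b \<tau>) ** ?W \<tau>) *v ?g \<tau>"
    and ?f6 = "\<lambda>\<tau>. (?W \<tau> *v ?g \<tau>) \<bullet> ?g \<tau>"
    and ?f8 = "\<lambda>\<tau>. ?R \<tau> *v ?v \<tau>"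
    and ?f9 = "\<lambda>\<tau>. (?R \<tau> *v ?v \<tau>) \<bullet> ?v \<tau>"
  note C = continuous_D[OF i]
  have int_scalar: "(f has_integral integral (D i) f) (D i)"
    if f: "continuous_on (D i) f" for f :: "real \<Rightarrow> real"
    using integrable_continuous_real[OF f] by (simp add: has_integral_integral)
  note cs = continuous_on_matrix_mult continuous_on_matrix_vector_mult continuous_on_transpose
    continuous_on_inner C
  note quad = quadratic_coefficients_has_integral[OF i]
  have 4: "((\<lambda>\<tau>. ?f4 \<tau> \<bullet> y) has_integral ZWZOmX p h i \<bullet> y) (D i)"
    unfolding ZWZOmX_def by (rule has_integral_vector_inner) (intro cs)
  have 5: "((\<lambda>\<tau>. ?f5 \<tau> \<bullet> c) has_integral ZBWZOmX p h i \<bullet> c) (D i)"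
    unfolding ZBWZOmX_def by (rule has_integral_vector_inner) (intro cs)
  have 6: "(?f6 has_integral WZOmX2 p h i) (D i)"
    unfolding WZOmX2_def by (rule int_scalar) (intro cs)
  have 7: "((\<lambda>\<tau>. (?R \<tau> *v c) \<bullet> c) has_integral (Rint p h i *v c) \<bullet> c) (D i)"
    unfolding Rint_def by (rule has_integral_matrix_inner) (intro cs)
  have 8: "((\<lambda>\<tau>. ?f8 \<tau> \<bullet> c) has_integral RV p h i \<bullet> c) (D i)"
    unfolding RV_def by (rule has_integral_vector_inner) (intro cs)
  have 9: "(?f9 has_integral RV2 p h i) (D i)"
    unfolding RV2_def by (rule int_scalar) (intro cs)
  have "((\<lambda>\<tau>. (?f1 \<tau> *v y) \<bullet> y + 2 * ((?f2 \<tau> *v y) \<bullet> c) + (?f3 \<tau> *v c) \<bullet> c + 2 * (?f4 \<tau> \<bullet> y) +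
      2 * (?f5 \<tau> \<bullet> c) + ?f6 \<tau> + (?R \<tau> *v c) \<bullet> c - 2 * (?f8 \<tau> \<bullet> c) + ?f9 \<tau>)
      has_integral step_cost i y c) (D i)"
    unfolding step_cost_def
    by (intro has_integral_add has_integral_diff has_integral_mult_right quad 4 5 6 7 8 9)
  moreover have "(?f1 \<tau> *v y) \<bullet> y + 2 * ((?f2 \<tau> *v y) \<bullet> c) + (?f3 \<tau> *v c) \<bullet> c + 2 * (?f4 \<tau> \<bullet> y) +
      2 * (?f5 \<tau> \<bullet> c) + ?f6 \<tau> + (?R \<tau> *v c) \<bullet> c - 2 * (?f8 \<tau> \<bullet> c) + ?f9 \<tau> =
      (?W \<tau> *v w y c \<tau>) \<bullet> w y c \<tau> + (?R \<tau> *v (c - ?v \<tau>)) \<bullet> (c - ?v \<tau>)"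
    if "\<tau> \<in> D i" for \<tau>
  proof -
    have \<tau>: "\<tau> \<in> I" using that D_subset[OF i] by auto
    show ?thesis
      unfolding w_def quadratic_form_expand[OF W_symmetric[OF \<tau>]]
      using symmetric_inner_commute[OF R_symmetric[OF \<tau>], of c "?v \<tau>"]
      by (simp only: matrix_vector_mult_diff_distrib inner_diff_left inner_diff_right)
  qed
  ultimately show ?thesis
    by (subst has_integral_cong[symmetric]) auto
qed

lemma cost_sampled:
  assumes u: "u \<in> sampled_controls p N h"
  shows "cost p u = 1/2 * ((Smat p *v (state p u (tb p) - qb p)) \<bullet> (state p u (tb p) - qb p)) +
    1/2 * (\<Sum>i<N. step_cost i (state p u (\<sigma> i)) (u (\<sigma> i)))"
proof -
  define f where "f \<tau> = (Wmat p \<tau> *v (state p u \<tau> - xref p \<tau>)) \<bullet> (state p u \<tau> - xref p \<tau>) +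
       (Rmat p \<tau> *v (u \<tau> - vref p \<tau>)) \<bullet> (u \<tau> - vref p \<tau>)" for \<tau>
  have step: "(f has_integral step_cost i (state p u (\<sigma> i)) (u (\<sigma> i))) (D i)" if i: "i < N" for i
  proof (rule has_integral_spike[OF _ _ step_cost_integral[OF i]])
    show "negligible {\<sigma> (Suc i)}" by simp
    fix \<tau> assume \<tau>: "\<tau> \<in> D i - {\<sigma> (Suc i)}"
    then have "u \<tau> = u (\<sigma> i)" by (intro sampled_value[OF u i]) auto
    moreover have "\<tau> \<in> D i" using \<tau> by simp
    ultimately show "f \<tau> =
      (Wmat p \<tau> *v (trans_mat p \<tau> (\<sigma> i) *v state p u (\<sigma> i) + beta p h i \<tau> *v u (\<sigma> i) + gamma p h i \<tau>)) \<bullet>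
        (trans_mat p \<tau> (\<sigma> i) *v state p u (\<sigma> i) + beta p h i \<tau> *v u (\<sigma> i) + gamma p h i \<tau>) +
      (Rmat p \<tau> *v (u (\<sigma> i) - vref p \<tau>)) \<bullet> (u (\<sigma> i) - vref p \<tau>)"
      unfolding f_def by (simp only: state_step[OF u i])
  qed
  have "(f has_integral (\<Sum>i<j. step_cost i (state p u (\<sigma> i)) (u (\<sigma> i)))) {\<sigma> 0..\<sigma> j}"
    if "j \<le> N" for j
    using that
  proof (induction j)
    case 0 then show ?case using has_integral_refl(2)[of f "\<sigma> 0"] by simp
  next
    case (Suc j)
    then have "j < N" by simp
    from has_integral_combine[OF _ _ Suc.IH step[OF this]] show ?case
      using node_mono[of 0 j] node_less[of j] Suc.prems by simp
  qed
  from this[of N] have "integral I f = (\<Sum>i<N. step_cost i (state p u (\<sigma> i)) (u (\<sigma> i)))"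
    by (simp add: node_0 node_N integral_unique)
  then show ?thesis unfolding cost_def f_def by simp
qed

end

section \<open>The Riccati recursion\<close>

lemma pos_def_matrix_inv:
  assumes "pos_def T"
  shows "T ** matrix_inv T = mat 1" and "matrix_inv T ** T = mat 1"
    and "transpose (matrix_inv T) = matrix_inv T"
proof -
  have "x = 0" if "T *v x = 0" for x
    using assms that unfolding pos_def_def by (metis inner_zero_left less_irrefl)
  then have "\<exists>B. B ** T = mat 1" unfolding matrix_left_invertible_ker by blast
  then obtain B where B: "B ** T = mat 1" "T ** B = mat 1"
    using matrix_left_right_inverse by blast
  \<comment> \<open>\<open>matrix_inv\<close> is a chosen two-sided inverse, so the existence of
    \<open>B\<close> is what entitles the choice to its property.\<close>
  have inv: "T ** matrix_inv T = mat 1 \<and> matrix_inv T ** T = mat 1"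
    unfolding matrix_inv_def by (rule someI[of _ B]) (use B in blast)
  then show r: "T ** matrix_inv T = mat 1" and l: "matrix_inv T ** T = mat 1" by auto
  have "transpose (matrix_inv T) ** T = mat 1"
    using arg_cong[OF r, of transpose] assms by (simp add: matrix_transpose_mul pos_def_def)
  then have "transpose (matrix_inv T) ** (T ** matrix_inv T) = matrix_inv T"
    by (simp only: matrix_mul_assoc matrix_mul_lid)
  then show "transpose (matrix_inv T) = matrix_inv T" by (simp only: r matrix_mul_rid)
qed

text \<open>Eliminating \<open>c\<close> leaves the Schur complement of \<open>T\<close> as
  quadratic part, with matching linear and constant parts. These remainders are exactly the
  right-hand sides of the recursions for K, J and Y.\<close>

lemma complete_square:
  fixes T :: "real^'m^'m" and P :: "real^'n^'m" and c H :: "real^'m" and y :: "real^'n"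
  assumes T: "pos_def T"
  defines "w \<equiv> c + matrix_inv T *v (P *v y + H)"
  shows "(Q *v y) \<bullet> y + 2 * ((P *v y) \<bullet> c) + (T *v c) \<bullet> c + 2 * (G \<bullet> y) + 2 * (H \<bullet> c) + F =
    (T *v w) \<bullet> w + ((Q - transpose P ** matrix_inv T ** P) *v y) \<bullet> y +
    2 * ((G - (transpose P ** matrix_inv T) *v H) \<bullet> y) + (F - (matrix_inv T *v H) \<bullet> H)"
proof -
  note inv = pos_def_matrix_inv[OF T]
  let ?i = "matrix_inv T" and ?r = "P *v y + H"
  have sT: "transpose T = T" using T by (simp add: pos_def_def)
  have Ti: "T *v (?i *v r) = r" for r
    by (simp add: matrix_vector_mul_assoc inv)
  have "(T *v w) \<bullet> w = (T *v c) \<bullet> c + 2 * (?r \<bullet> c) + (?i *v ?r) \<bullet> ?r"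
    using symmetric_inner_commute[OF sT, of c "?i *v ?r"]
    by (simp only: w_def matrix_vector_right_distrib[of T] Ti inner_add_left inner_add_right)
       (simp add: inner_commute inner_add_left inner_add_right)
  also have "(?i *v ?r) \<bullet> ?r =
      (?i *v (P *v y)) \<bullet> (P *v y) + 2 * ((?i *v H) \<bullet> (P *v y)) + (?i *v H) \<bullet> H"
    using symmetric_inner_commute[OF inv(3), of "P *v y" H]
    by (simp add: matrix_vector_right_distrib inner_add_left inner_add_right)
  finally show ?thesis
    by (simp only: matrix_vector_mult_diff_rdistrib inner_diff_left inner_transpose_mult
        inner_transpose_mult_vector inner_add_left) simp
qed

lemma transpose_integral:
  fixes M :: "real \<Rightarrow> real^'n^'m"
  assumes "M integrable_on S"
  shows "transpose (integral S M) = integral S (\<lambda>\<tau>. transpose (M \<tau>))"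
  using integral_linear[OF assms bounded_linear_transpose] by (simp add: o_def)

lemma transpose_add: "transpose (A + B) = transpose A + transpose (B :: real^'n^'m)"
  by (simp add: transpose_def vec_eq_iff)

lemma transpose_diff: "transpose (A - B) = transpose A - transpose (B :: real^'n^'m)"
  by (simp add: transpose_def vec_eq_iff)

lemma transpose_congruence:
  fixes W :: "real^'n^'n" and A :: "real^'k^'n"
  assumes "transpose W = W"
  shows "transpose (transpose A ** W ** A) = transpose A ** W ** A"
  using assms by (simp add: matrix_transpose_mul matrix_mul_assoc)

context lq_grid
begin

text \<open>Q, P, T, G, H and F are the coefficients, in \<open>y\<close> and \<open>c\<close>, of
  running cost plus next value. \<open>J\<close> and \<open>Y\<close> are arbitrary and
  \<open>K\<close> merely symmetric, which keeps this identity independent of the recursion.\<close>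

lemma step_value:
  fixes i :: nat
  assumes K: "transpose K = K"
  defines "z \<equiv> \<lambda>y c. stepZ p h i *v y + ZB p h i *v c + ZOm p N h i"
  shows "step_cost i y c + ((K *v z y c) \<bullet> z y c + 2 * (J \<bullet> z y c) + Y) =
    (Qop p h i K *v y) \<bullet> y + 2 * ((Pop p h i K *v y) \<bullet> c) + (Top p h i K *v c) \<bullet> c +
    2 * (Gop p N h i K J \<bullet> y) + 2 * (Hop p N h i K J \<bullet> c) + Fop p N h i K J Y"
proof -
  have J: "J \<bullet> z y c = (transpose (stepZ p h i) *v J) \<bullet> y + (transpose (ZB p h i) *v J) \<bullet> c +
      J \<bullet> ZOm p N h i"
    by (simp only: z_def inner_add_right inner_matrix_transpose)
  show ?thesis
    unfolding J unfolding z_def quadratic_form_expand[OF K] step_cost_def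
      Qop_def Pop_def Top_def Gop_def Hop_def Fop_def
    by (simp only: matrix_vector_mult_add_rdistrib inner_add_left inner_diff_left) simp
qed

section \<open>Symmetry and positivity along the recursion\<close>

lemma Wmat_nonneg: "t \<in> I \<Longrightarrow> 0 \<le> (Wmat p t *v x) \<bullet> x"
  using valid by (auto simp: valid_lq_def pos_semidef_def)

text \<open>The sum is the integral of the W-form at \<open>Z y + beta c\<close>. Joint
  nonnegativity in \<open>y\<close> and \<open>c\<close>, cross term included, is what the Schur
  complement argument requires.\<close>

lemma ZWZ_form_nonneg:
  assumes i: "i < N"
  shows "0 \<le> (ZWZ p h i *v y) \<bullet> y + 2 * ((ZBWZ p h i *v y) \<bullet> c) + (ZBWZB p h i *v c) \<bullet> c"
proof -
  note quad = quadratic_coefficients_has_integral[OF i]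
  let ?x = "\<lambda>\<tau>. trans_mat p \<tau> (\<sigma> i) *v y + beta p h i \<tau> *v c"
  show ?thesis
  proof (rule has_integral_nonneg)
    show "((\<lambda>\<tau>. ((transpose (trans_mat p \<tau> (\<sigma> i)) ** Wmat p \<tau> ** trans_mat p \<tau> (\<sigma> i)) *v y) \<bullet> y +
        2 * (((transpose (beta p h i \<tau>) ** Wmat p \<tau> ** trans_mat p \<tau> (\<sigma> i)) *v y) \<bullet> c) +
        ((transpose (beta p h i \<tau>) ** Wmat p \<tau> ** beta p h i \<tau>) *v c) \<bullet> c) has_integral
        (ZWZ p h i *v y) \<bullet> y + 2 * ((ZBWZ p h i *v y) \<bullet> c) + (ZBWZB p h i *v c) \<bullet> c) (D i)"
      by (intro has_integral_add has_integral_mult_right quad)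
    fix \<tau> assume "\<tau> \<in> D i"
    then have \<tau>: "\<tau> \<in> I" using D_subset[OF i] by auto
    show "0 \<le> ((transpose (trans_mat p \<tau> (\<sigma> i)) ** Wmat p \<tau> ** trans_mat p \<tau> (\<sigma> i)) *v y) \<bullet> y +
        2 * (((transpose (beta p h i \<tau>) ** Wmat p \<tau> ** trans_mat p \<tau> (\<sigma> i)) *v y) \<bullet> c) +
        ((transpose (beta p h i \<tau>) ** Wmat p \<tau> ** beta p h i \<tau>) *v c) \<bullet> c"
      using quadratic_form_expand[OF W_symmetric[OF \<tau>],
          of "trans_mat p \<tau> (\<sigma> i)" y "beta p h i \<tau>" c 0] Wmat_nonneg[OF \<tau>, of "?x \<tau>"]
      by (simp only: matrix_vector_mult_0_right inner_zero_left inner_zero_right mult_zero_right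
          add_0_right)
  qed
qed

lemma ZWZ_symmetric:
  assumes i: "i < N"
  shows "transpose (ZWZ p h i) = ZWZ p h i" and "transpose (ZBWZB p h i) = ZBWZB p h i"
    and "transpose (Rint p h i) = Rint p h i"
proof -
  note cs = integrable_continuous_real continuous_on_matrix_mult continuous_on_transpose
    continuous_D[OF i]
  have I: "\<tau> \<in> I" if "\<tau> \<in> D i" for \<tau> using that D_subset[OF i] by auto
  show "transpose (ZWZ p h i) = ZWZ p h i"
    unfolding ZWZ_def
    by (subst transpose_integral, intro cs, rule integral_cong,
        rule transpose_congruence[OF W_symmetric[OF I]])
  show "transpose (ZBWZB p h i) = ZBWZB p h i"
    unfolding ZBWZB_def
    by (subst transpose_integral, intro cs, rule integral_cong,
        rule transpose_congruence[OF W_symmetric[OF I]])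
  show "transpose (Rint p h i) = Rint p h i"
    unfolding Rint_def
    by (subst transpose_integral, intro cs, rule integral_cong, rule R_symmetric[OF I])
qed

lemma Rint_pos:
  assumes i: "i < N" and x: "x \<noteq> 0"
  shows "0 < (Rint p h i *v x) \<bullet> x"
proof -
  have "integral (D i) (\<lambda>_. 0) < integral (D i) (\<lambda>\<tau>. (Rmat p \<tau> *v x) \<bullet> x)"
  proof (rule integral_less_real)
    show "continuous_on (D i) (\<lambda>\<tau>. (Rmat p \<tau> *v x) \<bullet> x)"
      by (intro continuous_on_inner continuous_on_matrix_vector_mult continuous_D[OF i]
          continuous_on_const)
    show "{\<sigma> i<..<\<sigma> (Suc i)} \<noteq> {}" using node_less[OF i] by simp
    fix \<tau> assume "\<tau> \<in> {\<sigma> i<..<\<sigma> (Suc i)}"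
    then have "\<tau> \<in> I" using D_subset[OF i] by auto
    then show "0 < (Rmat p \<tau> *v x) \<bullet> x"
      using valid x by (auto simp: valid_lq_def pos_def_def)
  qed simp
  then show ?thesis
    using integral_unique[OF has_integral_matrix_inner[OF continuous_D(5)[OF i]], of x x]
    by (simp add: Rint_def)
qed

text \<open>The terms from \<open>K\<close> and W are only nonnegative; strictness comes from the
  integral of R.\<close>

lemma Top_pos_def:
  assumes i: "i < N" and K: "pos_semidef K"
  shows "pos_def (Top p h i K)"
  unfolding pos_def_def
proof (intro conjI allI impI)
  have sK: "transpose K = K" using K by (simp add: pos_semidef_def)
  show "transpose (Top p h i K) = Top p h i K"
    unfolding Top_def
    by (simp only: transpose_add ZWZ_symmetric[OF i] transpose_congruence[OF sK])
  fix c :: "real^'m" assume c: "c \<noteq> 0"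
  have "(Top p h i K *v c) \<bullet> c = (K *v (ZB p h i *v c)) \<bullet> (ZB p h i *v c) +
      (ZBWZB p h i *v c) \<bullet> c + (Rint p h i *v c) \<bullet> c"
    unfolding Top_def by (simp only: matrix_vector_mult_add_rdistrib inner_add_left inner_transpose_mult)
  moreover have "0 \<le> (ZBWZB p h i *v c) \<bullet> c"
    using ZWZ_form_nonneg[OF i, of 0 c] by simp
  moreover have "0 \<le> (K *v (ZB p h i *v c)) \<bullet> (ZB p h i *v c)"
    using K by (simp add: pos_semidef_def)
  ultimately show "0 < (Top p h i K *v c) \<bullet> c" using Rint_pos[OF i c] by linarith
qed

lemma riccati_step_pos_semidef:
  assumes i: "i < N" and K: "pos_semidef K"
  shows "pos_semidef (Qop p h i K - transpose (Pop p h i K) ** matrix_inv (Top p h i K) ** Pop p h i K)"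
    (is "pos_semidef (?Q - transpose ?P ** matrix_inv ?T ** ?P)")
  unfolding pos_semidef_def
proof (intro conjI allI)
  have sK: "transpose K = K" using K by (simp add: pos_semidef_def)
  note T = Top_pos_def[OF i K]
  show "transpose (?Q - transpose ?P ** matrix_inv ?T ** ?P) = ?Q - transpose ?P ** matrix_inv ?T ** ?P"
    unfolding Qop_def
    by (simp only: transpose_diff transpose_add transpose_congruence[OF sK] ZWZ_symmetric[OF i]
        transpose_congruence[OF pos_def_matrix_inv(3)[OF T]])
  fix y
  \<comment> \<open>The minimising control value for zero linear and constant terms: the completed
    square vanishes, so the form of the new K at \<open>y\<close> equals the joint form at
    \<open>(y, c)\<close>.\<close>
  define c where "c = - (matrix_inv ?T *v (?P *v y))"
  let ?z = "stepZ p h i *v y + ZB p h i *v c"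
  have "((?Q - transpose ?P ** matrix_inv ?T ** ?P) *v y) \<bullet> y =
      (?Q *v y) \<bullet> y + 2 * ((?P *v y) \<bullet> c) + (?T *v c) \<bullet> c"
    using complete_square[OF T, of ?Q y ?P c 0 0 0] by (simp add: c_def)
  also have "\<dots> = (K *v ?z) \<bullet> ?z +
      ((ZWZ p h i *v y) \<bullet> y + 2 * ((ZBWZ p h i *v y) \<bullet> c) + (ZBWZB p h i *v c) \<bullet> c) +
      (Rint p h i *v c) \<bullet> c"
    using quadratic_form_expand[OF sK, of "stepZ p h i" y "ZB p h i" c 0]
    unfolding Qop_def Pop_def Top_def
    by (simp only: matrix_vector_mult_add_rdistrib inner_add_left matrix_vector_mult_0_right
        inner_zero_left inner_zero_right mult_zero_right add_0_right) simp
  also have "\<dots> \<ge> 0"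
  proof -
    have "0 \<le> (K *v ?z) \<bullet> ?z" using K by (simp only: pos_semidef_def)
    moreover have "0 \<le> (Rint p h i *v c) \<bullet> c"
      using Rint_pos[OF i, of c] by (cases "c = 0") auto
    ultimately show ?thesis using ZWZ_form_nonneg[OF i, of y c] by linarith
  qed
  finally show "0 \<le> ((?Q - transpose ?P ** matrix_inv ?T ** ?P) *v y) \<bullet> y" .
qed

lemma Kseq_pos_semidef: "i \<le> N \<Longrightarrow> pos_semidef (Kseq p N h i)"
proof (induction i rule: inc_induct)
  case base
  then show ?case using valid by (subst Kseq.simps) (simp add: valid_lq_def)
next
  case (step i)
  then show ?case
    by (subst Kseq.simps) (simp add: Let_def riccati_step_pos_semidef)
qed

lemma Tmat_pos_def: "i < N \<Longrightarrow> pos_def (Tmat p N h i)"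
  unfolding Tmat_def by (intro Top_pos_def Kseq_pos_semidef) auto

text \<open>The function V_i, on the scale of twice the cost. At index \<open>N\<close> its argument
  is the terminal deviation from \<open>qb p\<close>, not the state.\<close>

definition cost_to_go :: "nat \<Rightarrow> real^'n \<Rightarrow> real" where
  "cost_to_go i z = (Kseq p N h i *v z) \<bullet> z + 2 * (Jseq p N h i \<bullet> z) + Yseq p N h i"

definition feedback :: "nat \<Rightarrow> real^'n \<Rightarrow> real^'m" where
  "feedback i y = - (matrix_inv (Tmat p N h i) *v (Pmat p N h i *v y + Hvec p N h i))"

text \<open>Bellman's equation with the loss made explicit: the last term is the price of deviating
  from the feedback value, so minimising over \<open>c\<close> leaves
  \<open>cost_to_go i y\<close>.\<close>

lemma bellman:
  assumes i: "i < N"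
  shows "step_cost i y c + cost_to_go (Suc i) (stepZ p h i *v y + ZB p h i *v c + ZOm p N h i) =
    cost_to_go i y + (Tmat p N h i *v (c - feedback i y)) \<bullet> (c - feedback i y)"
proof -
  let ?K = "Kseq p N h (Suc i)" and ?J = "Jseq p N h (Suc i)" and ?Y = "Yseq p N h (Suc i)"
  let ?T = "Top p h i ?K" and ?P = "Pop p h i ?K" and ?H = "Hop p N h i ?K ?J"
  have K: "Kseq p N h i = Qop p h i ?K - transpose ?P ** matrix_inv ?T ** ?P"
    using i by (subst Kseq.simps) (simp add: Let_def)
  have J: "Jseq p N h i = Gop p N h i ?K ?J - (transpose ?P ** matrix_inv ?T) *v ?H"
    using i by (subst Jseq.simps) (simp add: Let_def)
  have Y: "Yseq p N h i = Fop p N h i ?K ?J ?Y - (matrix_inv ?T *v ?H) \<bullet> ?H"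
    using i by (subst Yseq.simps) (simp add: Let_def)
  have psd: "pos_semidef ?K" using i by (intro Kseq_pos_semidef) simp
  then have sK: "transpose ?K = ?K" by (simp add: pos_semidef_def)
  show ?thesis
    unfolding cost_to_go_def step_value[OF sK] complete_square[OF Top_pos_def[OF i psd]]
      K J Y feedback_def Tmat_def Pmat_def Hvec_def
    by simp
qed

section \<open>Telescoping over the grid\<close>

lemma state_ta:
  assumes "u \<in> sampled_controls p N h"
  shows "state p u (ta p) = qa p"
  by (simp add: state_sampled[OF assms ta_in] Phi_ta)

lemma cost_complete_square:
  assumes u: "u \<in> sampled_controls p N h"
  defines "w \<equiv> \<lambda>i. u (\<sigma> i) - feedback i (state p u (\<sigma> i))"
  shows "cost p u = 1/2 * cost_to_go 0 (qa p) + 1/2 * (\<Sum>i<N. (Tmat p N h i *v w i) \<bullet> w i)"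
proof -
  \<comment> \<open>Only the last node is shifted by \<open>qb p\<close>. Since \<open>N\<close> is
    at least 1, the sequence still starts at \<open>qa p\<close>.\<close>
  define z where "z i = state p u (\<sigma> i) - (if i = N then qb p else 0)" for i
  have "(\<Sum>i<j. step_cost i (state p u (\<sigma> i)) (u (\<sigma> i))) + cost_to_go j (z j) =
      cost_to_go 0 (qa p) + (\<Sum>i<j. (Tmat p N h i *v w i) \<bullet> w i)" if "j \<le> N" for j
    using that
  proof (induction j)
    case 0 then show ?case using N_pos by (simp add: z_def node_0 state_ta[OF u])
  next
    case (Suc j)
    then have j: "j < N" by simp
    have zS: "z (Suc j) = stepZ p h j *v state p u (\<sigma> j) + ZB p h j *v u (\<sigma> j) + ZOm p N h j"
      using state_node[OF u j] by (simp add: z_def)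
    have zj: "z j = state p u (\<sigma> j)" using j by (simp add: z_def)
    show ?case
      using Suc.IH j bellman[OF j, of "state p u (\<sigma> j)" "u (\<sigma> j)"]
      by (simp add: zS[symmetric] zj w_def)
  qed
  \<comment> \<open>At index \<open>N\<close> the recursion supplies S, 0 and 0, so the value there
    is twice the terminal cost.\<close>
  from this[of N] have "(\<Sum>i<N. step_cost i (state p u (\<sigma> i)) (u (\<sigma> i))) +
      (Smat p *v z N) \<bullet> z N = cost_to_go 0 (qa p) + (\<Sum>i<N. (Tmat p N h i *v w i) \<bullet> w i)"
    by (simp add: cost_to_go_def Kseq.simps[of p N h N] Jseq.simps[of p N h N] Yseq.simps[of p N h N])
  then show ?thesis
    unfolding cost_sampled[OF u] z_def by (simp add: node_N)
qed

end

section \<open>The optimal control\<close>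

context lq_grid
begin

definition step_control :: "(nat \<Rightarrow> real^'m) \<Rightarrow> real \<Rightarrow> real^'m" where
  "step_control U t = (\<Sum>i<N. indicator {\<sigma> i..<\<sigma> (Suc i)} t *\<^sub>R U i)"

lemma step_control_eq:
  assumes i: "i < N" and t: "t \<in> {\<sigma> i..<\<sigma> (Suc i)}"
  shows "step_control U t = U i"
proof -
  have "t \<notin> {\<sigma> j..<\<sigma> (Suc j)}" if j: "j < N" "j \<noteq> i" for j
  proof (cases "j < i")
    case True then show ?thesis using node_mono[of "Suc j" i] i t by auto
  next
    case False then show ?thesis using node_mono[of "Suc i" j] j t by auto
  qed
  then have "step_control U t = (\<Sum>j<N. if j = i then U i else 0)"
    unfolding step_control_def using t by (intro sum.cong) (auto simp: indicator_def)
  then show ?thesis using i by simp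
qed

lemma step_control_outside:
  assumes "t \<notin> {ta p..<tb p}"
  shows "step_control U t = 0"
proof -
  have "t \<notin> {\<sigma> i..<\<sigma> (Suc i)}" if "i < N" for i
    using node_in[of i] node_in[of "Suc i"] that assms by auto
  then show ?thesis
    unfolding step_control_def by (intro sum.neutral) (auto simp: indicator_def)
qed

lemma step_control_sampled: "step_control U \<in> sampled_controls p N h"
  unfolding sampled_controls_def
proof (intro CollectI conjI allI impI)
  fix i assume "i < N"
  then show "\<exists>c. \<forall>t\<in>{\<sigma> i..<\<sigma> (Suc i)}. step_control U t = c"
    by (intro exI[of _ "U i"]) (simp add: step_control_eq)
qed (rule step_control_outside)

lemma step_control_node: "i < N \<Longrightarrow> step_control U (\<sigma> i) = U i"
  using node_less[of i] by (intro step_control_eq) auto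

text \<open>Reduces equality of sampled controls to equality at the nodes, as needed both for
  uniqueness and for the representation by indicators.\<close>

lemma sampled_eq_step_control:
  assumes u: "u \<in> sampled_controls p N h"
  shows "u = step_control (\<lambda>i. u (\<sigma> i))"
proof
  fix t
  show "u t = step_control (\<lambda>i. u (\<sigma> i)) t"
  proof (cases "t \<in> {ta p..<tb p}")
    case True
    then obtain i where i: "i < N" "t \<in> {\<sigma> i..<\<sigma> (Suc i)}" using node_cover by blast
    show ?thesis unfolding step_control_eq[OF i] by (rule sampled_value[OF u i])
  next
    case False
    then show ?thesis using u by (simp add: step_control_outside sampled_controls_def)
  qed
qed

text \<open>Breaks a circularity: feedback needs the state, which needs the control. The node states
  are predicted by forward recursion alone; the final \<open>qb p\<close> undoes the shift in the
  last \<open>ZOm\<close>.\<close>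

primrec closed_loop :: "nat \<Rightarrow> real^'n" where
  "closed_loop 0 = qa p"
| "closed_loop (Suc i) = stepZ p h i *v closed_loop i + ZB p h i *v feedback i (closed_loop i) +
     ZOm p N h i + (if Suc i = N then qb p else 0)"

definition closed_loop_control :: "real \<Rightarrow> real^'m" where
  "closed_loop_control = step_control (\<lambda>i. feedback i (closed_loop i))"

text \<open>The disjunction serves two purposes: the first case is the optimality condition on an arbitrary
  control, the second one is the definition of the closed-loop control.\<close>

lemma closed_loop_state:
  assumes u: "u \<in> sampled_controls p N h" and i: "i \<le> N"
    and fb: "\<And>j. j < i \<Longrightarrow> u (\<sigma> j) = feedback j (state p u (\<sigma> j)) \<or>
      u (\<sigma> j) = feedback j (closed_loop j)"
  shows "state p u (\<sigma> i) = closed_loop i"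
  using i fb
proof (induction i)
  case 0 then show ?case by (simp add: node_0 state_ta[OF u])
next
  case (Suc i)
  then have "state p u (\<sigma> i) = closed_loop i" by simp
  moreover from this Suc.prems(2)[of i] have "u (\<sigma> i) = feedback i (closed_loop i)" by auto
  ultimately show ?case using state_node[OF u, of i] Suc.prems(1) by (simp add: algebra_simps)
qed

section \<open>Optimality of the closed-loop control\<close>

lemma closed_loop_control_sampled: "closed_loop_control \<in> sampled_controls p N h"
  unfolding closed_loop_control_def by (rule step_control_sampled)

text \<open>The control was built from predicted states; here the prediction is matched with the
  actual state, which makes it a genuine feedback law.\<close>

lemma closed_loop_control_node:
  assumes i: "i < N"
  shows "closed_loop_control (\<sigma> i) = feedback i (state p closed_loop_control (\<sigma> i))"
proof -
  have c: "closed_loop_control (\<sigma> j) = feedback j (closed_loop j)" if "j < N" for j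
    using that by (simp add: closed_loop_control_def step_control_node)
  have "state p closed_loop_control (\<sigma> i) = closed_loop i"
    using i c by (intro closed_loop_state closed_loop_control_sampled) auto
  then show ?thesis using c[OF i] by simp
qed

lemma cost_closed_loop: "cost p closed_loop_control = 1/2 * cost_to_go 0 (qa p)"
  unfolding cost_complete_square[OF closed_loop_control_sampled]
  by (simp add: closed_loop_control_node)

lemma Tmat_form_nonneg: "i < N \<Longrightarrow> 0 \<le> (Tmat p N h i *v w) \<bullet> w"
  using Tmat_pos_def[of i] by (cases "w = 0") (auto simp: pos_def_def less_imp_le)

lemma cost_ge_closed_loop:
  assumes u: "u \<in> sampled_controls p N h"
  shows "cost p closed_loop_control \<le> cost p u"
  unfolding cost_complete_square[OF u] cost_closed_loop
  by (auto intro!: sum_nonneg Tmat_form_nonneg)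

text \<open>Equal cost makes a sum of nonnegative terms vanish, so by definiteness of each T_i every
  deviation is zero. The feedback law then fixes the node values one after the other.\<close>

lemma cost_eq_closed_loop_imp:
  assumes u: "u \<in> sampled_controls p N h" and c: "cost p u = cost p closed_loop_control"
  shows "u = closed_loop_control"
proof -
  let ?w = "\<lambda>i. u (\<sigma> i) - feedback i (state p u (\<sigma> i))"
  have "(\<Sum>i<N. (Tmat p N h i *v ?w i) \<bullet> ?w i) = 0"
    using c unfolding cost_complete_square[OF u] cost_closed_loop by simp
  then have 0: "(Tmat p N h i *v ?w i) \<bullet> ?w i = 0" if "i < N" for i
    using that by (subst (asm) sum_nonneg_eq_0_iff) (auto intro: Tmat_form_nonneg)
  have fb: "u (\<sigma> i) = feedback i (state p u (\<sigma> i))" if "i < N" for i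
    using 0[OF that] Tmat_pos_def[OF that] unfolding pos_def_def
    by (metis eq_iff_diff_eq_0 less_irrefl)
  have "u (\<sigma> i) = feedback i (closed_loop i)" if "i < N" for i
    using fb closed_loop_state[OF u, of i] that by simp
  then have "step_control (\<lambda>i. u (\<sigma> i)) = closed_loop_control"
    by (simp add: closed_loop_control_def step_control_def fun_eq_iff)
  then show ?thesis using sampled_eq_step_control[OF u] by simp
qed

lemma optimal_control_eq: "optimal_control p N h = closed_loop_control"
  unfolding optimal_control_def
proof (rule the_equality)
  show "is_arg_min (cost p) (\<lambda>u. u \<in> sampled_controls p N h) closed_loop_control"
    using closed_loop_control_sampled cost_ge_closed_loop by (auto simp: is_arg_min_def not_less)
  fix u assume "is_arg_min (cost p) (\<lambda>u. u \<in> sampled_controls p N h) u"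
  then have "u \<in> sampled_controls p N h" "cost p u \<le> cost p closed_loop_control"
    using closed_loop_control_sampled by (auto simp: is_arg_min_def not_less)
  then show "u = closed_loop_control"
    using cost_ge_closed_loop by (intro cost_eq_closed_loop_imp antisym) auto
qed

end

theorem theorem2:
  fixes p :: "('n::finite, 'm::finite) lq_problem"
    and N :: nat and h :: "nat \<Rightarrow> real"
  assumes "valid_lq p" and "valid_steps p N h"
  shows "optimal_control p N h =
           (\<lambda>t. \<Sum>i<N. indicator {node p h i..<node p h (Suc i)} t *\<^sub>R optimal_value p N h i) \<and>
         (\<forall>i<N. optimal_value p N h i =
           - (matrix_inv (Tmat p N h i) *v
               (Pmat p N h i *v state p (optimal_control p N h) (node p h i) + Hvec p N h i))) \<and>
         cost p (optimal_control p N h) =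
           1/2 * ((Kseq p N h 0 *v qa p) \<bullet> qa p) + Jseq p N h 0 \<bullet> qa p + 1/2 * Yseq p N h 0"
proof -
  obtain \<Phi> \<Psi> where "lq_flow p \<Phi> \<Psi>" using lq_flow_exists[OF assms(1)] by blast
  then interpret lq_grid p \<Phi> \<Psi> N h
    using assms(2) by (simp add: lq_grid_def lq_grid_axioms_def)
  \<comment> \<open>Any sampled control is the step function of its node values; for the optimal one
    these are, by definition, the \<open>optimal_value\<close>s.\<close>
  have eq: "optimal_control p N h = step_control (optimal_value p N h)"
    using sampled_eq_step_control[OF closed_loop_control_sampled]
    unfolding optimal_control_eq[symmetric] optimal_value_def[abs_def] .
  show ?thesis
  proof (intro conjI allI impI)
    show "optimal_control p N h =
        (\<lambda>t. \<Sum>i<N. indicator {node p h i..<node p h (Suc i)} t *\<^sub>R optimal_value p N h i)"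
      using eq by (simp add: step_control_def fun_eq_iff)
    show "optimal_value p N h i =
        - (matrix_inv (Tmat p N h i) *v
            (Pmat p N h i *v state p (optimal_control p N h) (node p h i) + Hvec p N h i))"
      if "i < N" for i
      using closed_loop_control_node[OF that]
      unfolding optimal_value_def optimal_control_eq feedback_def .
    show "cost p (optimal_control p N h) =
        1/2 * ((Kseq p N h 0 *v qa p) \<bullet> qa p) + Jseq p N h 0 \<bullet> qa p + 1/2 * Yseq p N h 0"
      unfolding optimal_control_eq cost_closed_loop cost_to_go_def by (simp add: field_simps)
  qed
qed

end
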